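(* Let $\mathcal{L}$ be any non-translation-invariant homogeneous linear equation. Then \textsc{\#Given-Size $\mathcal{L}$-Free Subset}, parameterised by $k$, admits an FPTRAS.
   Context: A homogeneous non-translation-invariant linear equation is one of the form $a_1x_1+\dots+a_kx_k=b_1y_1+\dots+b_\ell y_\ell$ with fixed $a_i,b_j\in\mathbb{N}$ and $a_1+\dots+a_k\neq b_1+\dots+b_\ell$. A solution is trivial if there is a partition of the variable positions into classes with equal entries within each class and signed coefficients summing to $0$ in each class. A set is $\mathcal{L}$-free if it contains no non-trivial solution. \textsc{\#Given-Size $\mathcal{L}$-Free Subset}: given a finite $A\subseteq\mathbb{Z}$ and $k\in\mathbb{N}$, compute the number $N$ of $\mathcal{L}$-free subsets of $A$ of size exactly $k$. An FPTRAS is a randomised algorithm that, given an instance $I$ of size $n$ and rationals $\varepsilon>0$, $0<\delta<1$, runs in time $f(k)\cdot g(n,1/\varepsilon,\log(1/\delta))$ with $f$ computable and $g$ polynomial, and outputs $z$ with $\mathbb{P}[(1-\varepsilon)N\le z\le(1+\varepsilon)N]\ge 1-\delta$. *)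

theory Defs
  imports "HOL-Probability.Probability" "HOL-Library.Log_Nat" "HOL-Library.Disjoint_Sets"
begin

section \<open>Solution-free sets\<close>

text \<open>
  The pair \<open>(as, bs)\<close> stands for the equation
  \<open>a\<^sub>1 x\<^sub>1 + \<dots> + a\<^sub>k x\<^sub>k = b\<^sub>1 y\<^sub>1 + \<dots> + b\<^sub>l y\<^sub>l\<close>.
  A solution is the list \<open>v = x @ y\<close> of all its entries; a variable position is an index of \<open>v\<close>.
\<close>

type_synonym linear_eq = "nat list \<times> nat list"

fun num_vars :: "linear_eq \<Rightarrow> nat" where
  "num_vars (as, bs) = length as + length bs"

fun is_solution :: "linear_eq \<Rightarrow> int list \<Rightarrow> bool" where
  "is_solution (as, bs) v \<longleftrightarrow> length v = num_vars (as, bs) \<and>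
     (\<Sum>i<length as. int (as ! i) * v ! i) =
     (\<Sum>j<length bs. int (bs ! j) * v ! (length as + j))"

fun signed_coeff :: "linear_eq \<Rightarrow> nat \<Rightarrow> int" where
  "signed_coeff (as, bs) i =
     (if i < length as then int (as ! i) else - int (bs ! (i - length as)))"

definition trivial_solution :: "linear_eq \<Rightarrow> int list \<Rightarrow> bool" where
  "trivial_solution L v \<longleftrightarrow> is_solution L v \<and>
     (\<exists>P. partition_on {..<num_vars L} P \<and>
          (\<forall>C\<in>P. (\<forall>i\<in>C. \<forall>j\<in>C. v ! i = v ! j) \<and> (\<Sum>i\<in>C. signed_coeff L i) = 0))"

definition eq_free :: "linear_eq \<Rightarrow> int set \<Rightarrow> bool" where
  "eq_free L S \<longleftrightarrow> \<not> (\<exists>v. set v \<subseteq> S \<and> is_solution L v \<and> \<not> trivial_solution L v)"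


section \<open>Randomised algorithms\<close>

text \<open>
  The model of computation is the random access machine with addition and subtraction as its only
  arithmetic operations, in the uniform cost measure, with structured control flow and fair coin
  flips.  Memory cells hold integers and are addressed by integers (indirect addressing is
  \<open>Cell (Cell e)\<close>).

  Expressions occur in the fixed program text, so evaluating one takes a constant number of
  additions, and charging one unit for it changes running times by at most a constant factor.
  Since there is no multiplication, after \<open>t\<close> steps all numbers in memory have at most
  \<open>O(t)\<close> bits more than the longest number of the input; hence unit cost is
  polynomially related to Turing machine time.
\<close>

type_synonym mem = "int \<Rightarrow> int"

datatype aexp = Const int | Cell aexp | Plus aexp aexp | Minus aexp aexp

datatype bexp = Lt aexp aexp | Eq aexp aexp | Neg bexp | Conj bexp bexp

datatype com =
    SKIP
  | Assign aexp aexp   \<comment> \<open>address, new contents\<close>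
  | Flip aexp          \<comment> \<open>store a fair coin flip, 0 or 1, at this address\<close>
  | Seq com com
  | Cond bexp com com
  | While bexp com

primrec aval :: "aexp \<Rightarrow> mem \<Rightarrow> int" where
  "aval (Const n) s = n"
| "aval (Cell e) s = s (aval e s)"
| "aval (Plus e1 e2) s = aval e1 s + aval e2 s"
| "aval (Minus e1 e2) s = aval e1 s - aval e2 s"

primrec bval :: "bexp \<Rightarrow> mem \<Rightarrow> bool" where
  "bval (Lt e1 e2) s \<longleftrightarrow> aval e1 s < aval e2 s"
| "bval (Eq e1 e2) s \<longleftrightarrow> aval e1 s = aval e2 s"
| "bval (Neg b) s \<longleftrightarrow> \<not> bval b s"
| "bval (Conj b1 b2) s \<longleftrightarrow> bval b1 s \<and> bval b2 s"

text \<open>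
  A configuration is the remaining program with the memory; \<open>SKIP\<close> is the halted
  program, and a halted configuration stays as it is.
\<close>

primrec step :: "com \<Rightarrow> mem \<Rightarrow> (com \<times> mem) pmf" where
  "step SKIP s = return_pmf (SKIP, s)"
| "step (Assign a e) s = return_pmf (SKIP, s(aval a s := aval e s))"
| "step (Flip a) s =
     map_pmf (\<lambda>b. (SKIP, s(aval a s := (if b then 1 else 0)))) (bernoulli_pmf (1 / 2))"
| "step (Seq c1 c2) s =
     (if c1 = SKIP then return_pmf (c2, s)
      else map_pmf (\<lambda>(c1', s'). (Seq c1' c2, s')) (step c1 s))"
| "step (Cond b c1 c2) s = return_pmf (if bval b s then c1 else c2, s)"
| "step (While b c) s = return_pmf (if bval b s then Seq c (While b c) else SKIP, s)"

primrec run :: "nat \<Rightarrow> com \<times> mem \<Rightarrow> (com \<times> mem) pmf" where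
  "run 0 cfg = return_pmf cfg"
| "run (Suc t) cfg = bind_pmf (run t cfg) (\<lambda>(c, s). step c s)"

text \<open>The bound holds for all outcomes of the coin flips.\<close>

definition halts_within :: "nat \<Rightarrow> com \<times> mem \<Rightarrow> bool" where
  "halts_within t cfg \<longleftrightarrow> (\<forall>cfg'\<in>set_pmf (run t cfg). fst cfg' = SKIP)"

definition load :: "int list \<Rightarrow> mem" where
  "load w i = (if 0 \<le> i \<and> i < int (length w) then w ! nat i else 0)"

definition computable :: "(nat \<Rightarrow> nat) \<Rightarrow> bool" where
  "computable f \<longleftrightarrow> (\<exists>prog. \<forall>k. \<exists>t s.
     run t (prog, load [int k]) = return_pmf (SKIP, s) \<and> s 0 = int (f k))"


section \<open>Fixed parameter tractable randomised approximation schemes\<close>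

text \<open>Length of a word of integers written in binary, with one more symbol per integer for its sign.\<close>

definition word_size :: "int list \<Rightarrow> nat" where
  "word_size w = (\<Sum>x\<leftarrow>w. nat (bitlen \<bar>x\<bar>) + 1)"

definition polynomial3 :: "(real \<Rightarrow> real \<Rightarrow> real \<Rightarrow> real) \<Rightarrow> bool" where
  "polynomial3 g \<longleftrightarrow> (\<exists>d (c :: nat \<Rightarrow> nat \<Rightarrow> nat \<Rightarrow> real). \<forall>x y z.
     g x y z = (\<Sum>i\<le>d. \<Sum>j\<le>d. \<Sum>l\<le>d. c i j l * x ^ i * y ^ j * z ^ l))"

text \<open>
  Initial memory on the instance word \<open>w\<close>: the numerators and denominators of \<open>\<epsilon>\<close> and \<open>\<delta>\<close>
  in lowest terms (\<open>quotient_of\<close>), then the length of \<open>w\<close>, then \<open>w\<close>.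
  The rational output is read off from cells 0 (numerator) and 1 (denominator).
\<close>

definition input_mem :: "rat \<Rightarrow> rat \<Rightarrow> int list \<Rightarrow> mem" where
  "input_mem \<epsilon> \<delta> w =
     load ([fst (quotient_of \<epsilon>), snd (quotient_of \<epsilon>),
            fst (quotient_of \<delta>), snd (quotient_of \<delta>), int (length w)] @ w)"

definition good_output :: "rat \<Rightarrow> nat \<Rightarrow> mem \<Rightarrow> bool" where
  "good_output \<epsilon> N s \<longleftrightarrow> s 1 \<noteq> 0 \<and>
     (1 - \<epsilon>) * of_nat N \<le> Fract (s 0) (s 1) \<and> Fract (s 0) (s 1) \<le> (1 + \<epsilon>) * of_nat N"

text \<open>
  A parameterised counting problem is given by the relation \<open>enc\<close> between instances and the
  words encoding them (an instance may have several), the parameter \<open>\<kappa>\<close>, and the number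
  \<open>num\<close> to be computed.  The size of an instance is that of the word by which it is presented.
\<close>

definition admits_FPTRAS ::
  "('i \<Rightarrow> int list \<Rightarrow> bool) \<Rightarrow> ('i \<Rightarrow> nat) \<Rightarrow> ('i \<Rightarrow> nat) \<Rightarrow> bool" where
  "admits_FPTRAS enc \<kappa> num \<longleftrightarrow>
     (\<exists>prog f g. computable f \<and> polynomial3 g \<and>
       (\<forall>I w (\<epsilon>::rat) (\<delta>::rat). enc I w \<and> 0 < \<epsilon> \<and> 0 < \<delta> \<and> \<delta> < 1 \<longrightarrow>
         (\<exists>t. real t \<le> real (f (\<kappa> I)) *
                 g (real (word_size w)) (1 / real_of_rat \<epsilon>) (log 2 (1 / real_of_rat \<delta>)) \<and>
              halts_within t (prog, input_mem \<epsilon> \<delta> w) \<and>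
              measure_pmf.prob (run t (prog, input_mem \<epsilon> \<delta> w))
                {(c, s). good_output \<epsilon> (num I) s} \<ge> 1 - real_of_rat \<delta>)))"


section \<open>Counting solution-free subsets of given size\<close>

text \<open>An instance is a pair \<open>(A, k)\<close>; the elements of \<open>A\<close> may be listed in any order.\<close>

fun encodes_subset_instance :: "int set \<times> nat \<Rightarrow> int list \<Rightarrow> bool" where
  "encodes_subset_instance (A, k) w \<longleftrightarrow> (\<exists>xs. distinct xs \<and> set xs = A \<and> w = int k # xs)"

fun num_eq_free_subsets :: "linear_eq \<Rightarrow> int set \<times> nat \<Rightarrow> nat" where
  "num_eq_free_subsets L (A, k) = card {S. S \<subseteq> A \<and> card S = k \<and> eq_free L S}"

end

theory Submission
  imports Defs "HOL-Number_Theory.Cong" "HOL-Computational_Algebra.Primes"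
begin

text \<open>
  Since the two coefficient sums differ, no solution is trivial, so a set is free iff it contains no
  solution at all.  By Erdos' dilation argument every set of \<open>n\<close> nonzero integers has a free subset
  of size at least \<open>c n\<close> with \<open>c > 0\<close> depending only on the equation; all subsets of a free
  set are free, so if there is a free \<open>k\<close>-subset at all, then the proportion of free ones is at
  least a positive bound depending on \<open>k\<close> alone.  Naive Monte Carlo sampling is
  therefore efficient.

  To sample with fair coins in worst-case bounded time, draw \<open>k\<close> indices uniformly from
  \<open>{..<2 ^ b}\<close>, where \<open>2 ^ b\<close> is the least power of two exceeding \<open>n\<close>, and reject unless they are
  strictly increasing, below \<open>n\<close>, and select a free set.  Exactly \<open>N\<close> of the \<open>2 ^ (b * k)\<close> outcomes
  are accepted, the number of accepted samples is binomially distributed, and Hoeffding's inequality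
  bounds the number of samples needed.
\<close>

section \<open>Programs as implementations of random experiments\<close>

text \<open>Hoeffding's inequality controls the additive error of the observed acceptance rate. With
  acceptance probability \<open>p\<close> and \<delta> at least 2^(-m), relative error \<epsilon>
  takes on the order of (m + 1) / (\<epsilon> p)^2 samples. The program cannot know
  \<open>p\<close>; it replaces 1 / \<open>p\<close> by a power \<open>B0 ^ (k + 1)\<^sup>2\<close>
  and 1 / \<epsilon> by an integer \<open>E\<close>. This bound on \<open>p\<close> fails if there
  is no free \<open>k\<close>-subset, but then no sample is accepted and the output is exactly 0.
  The dense free subset arises modulo a large prime \<open>q\<close>: with \<open>M\<close> the
  larger coefficient sum, take the elements that a multiplier \<open>r\<close> moves into an
  interval ending just below q / M, of length about q / M^2. The average over \<open>r\<close>
  yields a proportion of about 1 / M^2. Two features of the model shape the rest. Without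
  multiplication, all parameters come from counting, doubling and adding odd numbers, so dependence
  on \<open>k\<close> is always estimated by a constant to the power (k + 1)^2. As the time bound
  must hold for all coin flips, an invalid draw is not repeated but counted as a miss, and validity
  becomes part of \<open>p\<close>.\<close>

lemma run_add: "run (t + u) cfg = bind_pmf (run t cfg) (run u)"
proof (induction u)
  case 0
  have "(\<lambda>x. run 0 x) = return_pmf" by auto
  then show ?case by (simp add: bind_return_pmf')
next
  case (Suc u)
  then show ?case by (simp add: bind_assoc_pmf)
qed

lemma run_SKIP: "run t (SKIP, s) = return_pmf (SKIP, s)"
  by (induction t) (auto simp: bind_return_pmf)

lemma run_Suc_step: "run (Suc t) (c, s) = bind_pmf (step c s) (run t)"
proof -
  have "run 1 (c, s) = step c s" by (simp add: bind_return_pmf)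
  then show ?thesis using run_add[of 1 t "(c, s)"] by simp
qed

lemma halts_within_Suc:
  "halts_within (Suc t) (c, s) \<longleftrightarrow> (\<forall>cfg\<in>set_pmf (step c s). halts_within t cfg)"
  unfolding halts_within_def run_Suc_step by auto

lemma halts_within_0: "halts_within 0 (c, s) \<longleftrightarrow> c = SKIP"
  by (simp add: halts_within_def)

lemma run_halted_add:
  assumes "halts_within t cfg"
  shows "run (t + u) cfg = run t cfg"
proof -
  have "bind_pmf (run t cfg) (run u) = bind_pmf (run t cfg) return_pmf"
    using assms by (intro bind_pmf_cong) (auto simp: halts_within_def run_SKIP dest: bspec)
  then show ?thesis by (simp add: run_add bind_return_pmf')
qed

text \<open>The extra step discards the \<open>SKIP\<close> left by \<open>c1\<close>. Runs in which
  \<open>c1\<close> halts early enter \<open>c2\<close> early; their surplus steps change nothing,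
  since \<open>c2\<close> halts within \<open>u\<close> steps from every memory reached.\<close>

lemma run_Seq:
  assumes "halts_within t (c1, s)"
    and "\<And>c' s'. (c', s') \<in> set_pmf (run t (c1, s)) \<Longrightarrow> halts_within u (c2, s')"
  shows "run (t + u + 1) (Seq c1 c2, s) = bind_pmf (run t (c1, s)) (\<lambda>(_, s'). run u (c2, s'))"
  using assms
proof (induction t arbitrary: c1 s)
  case 0
  then show ?case
    using run_Suc_step[of u "Seq c1 c2" s] by (simp add: halts_within_0 bind_return_pmf del: run.simps(2))
next
  case (Suc t)
  show ?case
  proof (cases "c1 = SKIP")
    case True
    then have "halts_within u (c2, s)" using Suc.prems(2)[of SKIP s] by (simp add: run_SKIP del: run.simps(2))
    then have "run (u + Suc t) (c2, s) = run u (c2, s)" by (rule run_halted_add)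
    then show ?thesis
      using True run_Suc_step[of "Suc t + u" "Seq c1 c2" s]
      by (simp add: bind_return_pmf run_SKIP add.commute del: run.simps(2))
  next
    case False
    have "run (Suc t + u + 1) (Seq c1 c2, s) = bind_pmf (step (Seq c1 c2) s) (run (t + u + 1))"
      using run_Suc_step[of "t + u + 1"] by simp
    also have "\<dots> = bind_pmf (step c1 s) (\<lambda>(c', s'). run (t + u + 1) (Seq c' c2, s'))"
      using False by (simp add: bind_map_pmf case_prod_unfold del: run.simps(2))
    also have "\<dots> = bind_pmf (step c1 s)
        (\<lambda>cfg. bind_pmf (run t cfg) (\<lambda>(_, s'). run u (c2, s')))"
    proof (rule bind_pmf_cong[OF refl])
      fix cfg assume cfg: "cfg \<in> set_pmf (step c1 s)"
      obtain c' s' where [simp]: "cfg = (c', s')" by force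
      have "run (t + u + 1) (Seq c' c2, s') =
          bind_pmf (run t (c', s')) (\<lambda>(_, s'). run u (c2, s'))"
      proof (rule Suc.IH)
        show "halts_within t (c', s')"
          using Suc.prems(1) cfg by (auto simp: halts_within_Suc)
        show "halts_within u (c2, s'')" if "(c'', s'') \<in> set_pmf (run t (c', s'))" for c'' s''
          using that cfg Suc.prems(2)[of c'' s''] unfolding run_Suc_step by force
      qed
      then show "(case cfg of (c', s') \<Rightarrow> run (t + u + 1) (Seq c' c2, s')) =
          bind_pmf (run t cfg) (\<lambda>(_, s'). run u (c2, s'))"
        by simp
    qed
    also have "\<dots> = bind_pmf (run (Suc t) (c1, s)) (\<lambda>(_, s'). run u (c2, s'))"
      unfolding run_Suc_step bind_assoc_pmf ..
    finally show ?thesis .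
  qed
qed

text \<open>
  All runs halt within \<open>t\<close> steps, and the final memory can be coupled by \<open>R\<close> with the outcome of the
  random experiment \<open>M\<close>.  Deterministic total correctness is the case \<open>M = return_pmf ()\<close>.
\<close>

definition refines ::
  "com \<Rightarrow> mem \<Rightarrow> nat \<Rightarrow> (mem \<Rightarrow> 'a \<Rightarrow> bool) \<Rightarrow> 'a pmf \<Rightarrow> bool" where
  "refines c s t R M \<longleftrightarrow> rel_pmf (\<lambda>(c', s') a. c' = SKIP \<and> R s' a) (run t (c, s)) M"

lemma rel_pmfD_set1: "rel_pmf R p q \<Longrightarrow> x \<in> set_pmf p \<Longrightarrow> \<exists>y\<in>set_pmf q. R x y"
  using pmf.rel_transfer by (metis rel_pmf_imp_rel_set rel_setD1)

lemma refines_halts: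
  assumes "refines c s t R M"
  shows "halts_within t (c, s)"
  unfolding halts_within_def
  using rel_pmfD_set1[OF assms[unfolded refines_def]] by (fastforce split: prod.splits)

lemma refines_mono:
  assumes "refines c s t R M" "t \<le> t'" "\<And>s' a. R s' a \<Longrightarrow> R' s' a"
  shows "refines c s t' R' M"
proof -
  have "run t' (c, s) = run t (c, s)"
    using run_halted_add[OF refines_halts[OF assms(1)], of "t' - t"] assms(2) by simp
  then show ?thesis using assms(1,3) unfolding refines_def
    by (auto elim!: pmf.rel_mono_strong)
qed

lemma refines_step:
  assumes "rel_pmf (\<lambda>(c', s') a. refines c' s' t R (F a)) (step c s) M"
  shows "refines c s (Suc t) R (bind_pmf M F)"
  unfolding refines_def run_Suc_step
  by (rule rel_pmf_bindI[OF assms]) (auto simp: refines_def)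

lemma refines_step_return:
  assumes "step c s = return_pmf (c', s')" "refines c' s' t R M"
  shows "refines c s (Suc t) R M"
  using assms unfolding refines_def run_Suc_step by (simp add: bind_return_pmf)

text \<open>Couplings compose along \<open>bind_pmf\<close>. The budget \<open>u\<close> has to be
  uniform over the outcomes \<open>a\<close> of the first part.\<close>

lemma refines_Seq:
  assumes "refines c1 s t R M" "\<And>s' a. R s' a \<Longrightarrow> refines c2 s' u R' (F a)" "t + u + 1 \<le> t'"
  shows "refines (Seq c1 c2) s t' R' (bind_pmf M F)"
proof -
  have "halts_within u (c2, s')" if "(c', s') \<in> set_pmf (run t (c1, s))" for c' s'
    using rel_pmfD_set1[OF assms(1)[unfolded refines_def] that] assms(2) refines_halts by fastforce
  then have "run (t + u + 1) (Seq c1 c2, s) =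
      bind_pmf (run t (c1, s)) (\<lambda>(_, s'). run u (c2, s'))"
    using refines_halts[OF assms(1)] by (rule run_Seq[rotated])
  then have "refines (Seq c1 c2) s (t + u + 1) R' (bind_pmf M F)"
    unfolding refines_def using assms(2)
    by (auto intro!: rel_pmf_bindI[OF assms(1)[unfolded refines_def]] simp: refines_def simp del: run.simps)
  then show ?thesis by (rule refines_mono) (use assms(3) in auto)
qed

lemma refines_SKIP: "R s a \<Longrightarrow> refines SKIP s t R (return_pmf a)"
  by (simp add: refines_def run_SKIP)

lemma refines_Assign:
  assumes "R (s(aval a s := aval e s)) x" "1 \<le> t"
  shows "refines (Assign a e) s t R (return_pmf x)"
proof -
  have "refines (Assign a e) s (Suc 0) R (return_pmf x)"
    by (rule refines_step_return) (auto intro: refines_SKIP assms)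
  then show ?thesis by (rule refines_mono) (use assms(2) in auto)
qed

lemma refines_Flip:
  assumes "\<And>r. R (s(aval a s := of_bool r)) r" "1 \<le> t"
  shows "refines (Flip a) s t R (bernoulli_pmf (1 / 2))"
proof -
  have "refines (Flip a) s (Suc 0) R (bind_pmf (bernoulli_pmf (1 / 2)) return_pmf)"
    by (rule refines_step)
      (auto simp: pmf.rel_map intro!: rel_pmf_reflI refines_SKIP assms(1)[of True, simplified] assms(1)[of False, simplified])
  then show ?thesis unfolding bind_return_pmf' by (rule refines_mono) (use assms(2) in auto)
qed

lemma refines_Cond:
  assumes "bval b s \<Longrightarrow> refines c1 s t R M" "\<not> bval b s \<Longrightarrow> refines c2 s t R M" "t + 1 \<le> t'"
  shows "refines (Cond b c1 c2) s t' R M"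
proof -
  have "refines (Cond b c1 c2) s (Suc t) R M"
    by (rule refines_step_return) (use assms(1,2) in auto)
  then show ?thesis by (rule refines_mono) (use assms(3) in auto)
qed

lemma refines_Assign_Seq:
  assumes "refines c (s(aval a s := aval e s)) t R M" "t + 2 \<le> t'"
  shows "refines (Seq (Assign a e) c) s t' R M"
  using refines_Seq[where M = "return_pmf ()" and F = "\<lambda>_. M" and t = 1,
      OF refines_Assign[where R = "\<lambda>s' _. s' = s(aval a s := aval e s)"]] assms
  by (auto simp: bind_return_pmf)

text \<open>The budget of the remaining program is computed from the goal, so that automation can
  run through straight-line code with concrete budgets.\<close>

lemma refines_Assign_Seq_diff:
  assumes "refines c (s(aval a s := aval e s)) (t - 2) R M" "2 \<le> t"
  shows "refines (Seq (Assign a e) c) s t R M"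
  using assms by (intro refines_Assign_Seq) auto

lemma refines_Seq_det:
  assumes "refines c1 s t (\<lambda>s' _. Q s') (return_pmf ())"
    "\<And>s'. Q s' \<Longrightarrow> refines c2 s' u R M" "t + u + 1 \<le> t'"
  shows "refines (Seq c1 c2) s t' R M"
proof -
  have "refines (Seq c1 c2) s t' R (bind_pmf (return_pmf ()) (\<lambda>_. M))"
    by (rule refines_Seq[OF assms(1)]) (use assms(2,3) in auto)
  then show ?thesis by (simp add: bind_return_pmf)
qed

section \<open>Iterated experiments and counted loops\<close>

primrec iter_pmf :: "nat \<Rightarrow> ('a \<Rightarrow> 'a pmf) \<Rightarrow> 'a \<Rightarrow> 'a pmf" where
  "iter_pmf 0 F a = return_pmf a"
| "iter_pmf (Suc n) F a = bind_pmf (F a) (iter_pmf n F)"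

lemma iter_pmf_return [simp]: "iter_pmf n return_pmf a = return_pmf a"
  by (induction n) (auto simp: bind_return_pmf)

lemma iter_pmf_Suc_right: "iter_pmf (Suc n) F a = bind_pmf (iter_pmf n F a) F"
proof (induction n arbitrary: a)
  case 0
  have "iter_pmf 0 F = return_pmf" by auto
  then show ?case by (simp add: bind_return_pmf bind_return_pmf')
next
  case (Suc n)
  have "iter_pmf (Suc n) F = (\<lambda>a. bind_pmf (iter_pmf n F a) F)" using Suc by (rule ext)
  then have "iter_pmf (Suc (Suc n)) F a = bind_pmf (F a) (\<lambda>a. bind_pmf (iter_pmf n F a) F)"
    by (simp only: iter_pmf.simps(2)[of "Suc n"])
  then show ?case by (simp add: bind_assoc_pmf)
qed

text \<open>The invariant is indexed by the number of completed rounds, and the number of rounds is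
  the same for all coin flips. Besides the body, a round pays one step for the guard and one for
  dropping the finished body; the last \<open>+ 1\<close> is the failing guard.\<close>

lemma refines_While:
  assumes body: "\<And>i s a. i < n \<Longrightarrow> I i s a \<Longrightarrow> bval b s \<and> refines c s t (I (Suc i)) (F a)"
    and exit: "\<And>s a. I n s a \<Longrightarrow> \<not> bval b s"
    and init: "I 0 s a" and time: "n * (t + 2) + 1 \<le> t'"
  shows "refines (While b c) s t' (I n) (iter_pmf n F a)"
proof -
  have "refines (While b c) s (k * (t + 2) + 1) (I n) (iter_pmf k F a)"
    if "I i s a" "i + k = n" for i k s a
    using that
  proof (induction k arbitrary: i s a)
    case 0
    then have "refines (While b c) s (Suc 0) (I n) (return_pmf a)"
      by (intro refines_step_return[where c' = SKIP] refines_SKIP) (use exit in auto)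
    then show ?case by simp
  next
    case (Suc k)
    then have b: "bval b s" "refines c s t (I (Suc i)) (F a)" using body[of i s a] by auto
    have "refines (Seq c (While b c)) s (Suc k * (t + 2)) (I n) (bind_pmf (F a) (iter_pmf k F))"
      by (rule refines_Seq[OF b(2) Suc.IH]) (use Suc.prems in auto)
    then have "refines (While b c) s (Suc (Suc k * (t + 2))) (I n) (bind_pmf (F a) (iter_pmf k F))"
      by (rule refines_step_return[rotated]) (use b in auto)
    then show ?case by simp
  qed
  then have "refines (While b c) s (n * (t + 2) + 1) (I n) (iter_pmf n F a)" using init by simp
  then show ?thesis by (rule refines_mono) (use time in auto)
qed

lemma refines_While_det:
  assumes "\<And>i s. i < n \<Longrightarrow> I i s \<Longrightarrow> bval b s \<and> refines c s t (\<lambda>s' _. I (Suc i) s') (return_pmf ())"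
    and "\<And>s. I n s \<Longrightarrow> \<not> bval b s" and "I 0 s" and "n * (t + 2) + 1 \<le> t'"
  shows "refines (While b c) s t' (\<lambda>s' _. I n s') (return_pmf ())"
proof -
  have "refines (While b c) s t' (\<lambda>s' _. I n s') (iter_pmf n return_pmf ())"
    by (rule refines_While[where I = "\<lambda>i s' _. I i s'" and t = t]) (use assms in auto)
  then show ?thesis by simp
qed

text \<open>\<open>computable\<close> asks for one final memory, whereas \<open>refines\<close> with
  outcome \<open>()\<close> only says that all final memories satisfy the postcondition. Without
  coin flips the run is a point distribution, which closes this gap.\<close>

primrec flip_free :: "com \<Rightarrow> bool" where
  "flip_free SKIP \<longleftrightarrow> True"
| "flip_free (Assign a e) \<longleftrightarrow> True"
| "flip_free (Flip a) \<longleftrightarrow> False"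
| "flip_free (Seq c1 c2) \<longleftrightarrow> flip_free c1 \<and> flip_free c2"
| "flip_free (Cond b c1 c2) \<longleftrightarrow> flip_free c1 \<and> flip_free c2"
| "flip_free (While b c) \<longleftrightarrow> flip_free c"

lemma flip_free_step:
  "flip_free c \<Longrightarrow> \<exists>c' s'. step c s = return_pmf (c', s') \<and> flip_free c'"
  by (induction c) fastforce+

lemma flip_free_run:
  "flip_free c \<Longrightarrow> \<exists>c' s'. run t (c, s) = return_pmf (c', s') \<and> flip_free c'"
proof (induction t)
  case (Suc t)
  then obtain c' s' where "run t (c, s) = return_pmf (c', s')" "flip_free c'" by auto
  then show ?case using flip_free_step[of c' s'] by (simp add: bind_return_pmf)
qed auto

lemma refines_flip_free:
  assumes "flip_free c" "refines c s t (\<lambda>s' _. Q s') (return_pmf ())"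
  shows "\<exists>s'. run t (c, s) = return_pmf (SKIP, s') \<and> Q s'"
  using flip_free_run[OF assms(1), of t s] assms(2) unfolding refines_def by auto

section \<open>The programs\<close>

notation Seq (infixr ";;" 60)

abbreviation V :: "int \<Rightarrow> aexp" where "V i \<equiv> Cell (Const i)"
abbreviation assign :: "int \<Rightarrow> aexp \<Rightarrow> com" (infix "::=" 61) where "i ::= e \<equiv> Assign (Const i) e"

text \<open>The program variables have negative addresses, which keeps them apart from the input.\<close>

abbreviation (input) "tmp \<equiv> - 1 :: int"
abbreviation (input) "odd_cell \<equiv> - 2 :: int"
abbreviation (input) "sqr \<equiv> - 3 :: int"
abbreviation (input) "tot \<equiv> - 4 :: int"
abbreviation (input) "cnt \<equiv> - 5 :: int"
abbreviation (input) "hits \<equiv> - 6 :: int"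
abbreviation (input) "wgt \<equiv> - 7 :: int"
abbreviation (input) "prv \<equiv> - 8 :: int"
abbreviation (input) "pos \<equiv> - 9 :: int"
abbreviation (input) "idx \<equiv> - 10 :: int"
abbreviation (input) "pw \<equiv> - 11 :: int"
abbreviation (input) "coin \<equiv> - 12 :: int"

text \<open>Products with constants are unrolled into sums in the program text. The coefficients and
  the base \<open>B\<close> depend on the equation only, so this is legitimate.\<close>

primrec nscale :: "nat \<Rightarrow> aexp \<Rightarrow> aexp" where
  "nscale 0 e = Const 0"
| "nscale (Suc n) e = Plus e (nscale n e)"

definition scale :: "int \<Rightarrow> aexp \<Rightarrow> aexp" where
  "scale c e = (if 0 \<le> c then nscale (nat c) e else Minus (Const 0) (nscale (nat (- c)) e))"

lemma aval_nscale [simp]: "aval (nscale n e) s = int n * aval e s"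
  by (induction n) (auto simp: algebra_simps)

lemma aval_scale [simp]: "aval (scale c e) s = c * aval e s"
  by (simp add: scale_def)

text \<open>
  In the absence of multiplication, squares are computed as sums of consecutive odd numbers.
\<close>

definition pow_code :: "int \<Rightarrow> nat \<Rightarrow> com" where
  "pow_code a B =
     (sqr ::= Const 0 ;; odd_cell ::= Const 1 ;; cnt ::= Const 0 ;;
      While (Neg (Lt (V a) (V cnt)))
        (sqr ::= Plus (V sqr) (V odd_cell) ;; odd_cell ::= Plus (V odd_cell) (Const 2) ;;
         cnt ::= Plus (V cnt) (Const 1)) ;;
      While (Lt (Const 0) (V sqr))
        (tot ::= nscale B (V tot) ;; sqr ::= Minus (V sqr) (Const 1)))"

lemma flip_free_pow_code: "flip_free (pow_code a B)"
  by (simp add: pow_code_def)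

text \<open>The first guard still admits \<open>cnt = k\<close>, so there are \<open>k + 1\<close>
  rounds, and the sum of the first \<open>k + 1\<close> odd numbers then counts the multiplications
  by \<open>B\<close>.\<close>

lemma refines_pow_code:
  assumes "0 \<le> a" "s a = int k" "s tot = int x"
  shows "refines (pow_code a B) s (21 * (k + 1)\<^sup>2)
    (\<lambda>s' _. s' tot = int (x * B ^ (k + 1)\<^sup>2) \<and>
       (\<forall>i. i \<notin> {sqr, odd_cell, cnt, tot} \<longrightarrow> s' i = s i)) (return_pmf ())"
proof -
  let ?frame = "\<lambda>s'. \<forall>i. i \<notin> {sqr, odd_cell, cnt, tot} \<longrightarrow> s' i = s i"
  have 1: "refines (While (Neg (Lt (V a) (V cnt)))
        (sqr ::= Plus (V sqr) (V odd_cell) ;; odd_cell ::= Plus (V odd_cell) (Const 2) ;;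
         cnt ::= Plus (V cnt) (Const 1))) s' ((k + 1) * 7 + 1)
    (\<lambda>s' _. s' sqr = int ((k + 1)\<^sup>2) \<and> s' odd_cell = 2 * int (k + 1) + 1 \<and> s' cnt = int (k + 1) \<and>
      s' tot = int x \<and> ?frame s') (return_pmf ())"
    if "s' sqr = 0" "s' odd_cell = 1" "s' cnt = 0" "s' tot = int x" "?frame s'" for s'
  proof (rule refines_While_det[where t = 5 and I = "\<lambda>i s'. s' sqr = int (i\<^sup>2) \<and>
      s' odd_cell = 2 * int i + 1 \<and> s' cnt = int i \<and> s' tot = int x \<and> ?frame s'"], goal_cases)
    case (1 i s')
    have "s' a = int k" using 1 assms by auto
    then show ?case using 1 assms
      by (auto intro!: refines_Assign_Seq_diff refines_Assign
          simp: power2_eq_square algebra_simps)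
  next
    case (2 s')
    then have "s' a = int k" using assms by auto
    then show ?case using 2 by auto
  qed (use that in auto)
  have 2: "refines (While (Lt (Const 0) (V sqr))
        (tot ::= nscale B (V tot) ;; sqr ::= Minus (V sqr) (Const 1))) s' (m * 5 + 1)
    (\<lambda>s' _. s' sqr = int (m - m) \<and> s' tot = int (x * B ^ m) \<and> ?frame s') (return_pmf ())"
    if "s' sqr = int m" "s' tot = int x" "?frame s'" for s' m
    by (rule refines_While_det[where t = 3 and I = "\<lambda>i s'. s' sqr = int (m - i) \<and>
      s' tot = int (x * B ^ i) \<and> ?frame s'"])
     (use that in \<open>auto intro!: refines_Assign_Seq_diff refines_Assign simp: of_nat_diff\<close>)
  \<comment> \<open>With x = k + 1 the exact budget is 5 x^2 + 7 x + 9, which is at most 21 x^2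
    because x is at least 1.\<close>
  have le: "k + 1 \<le> (k + 1)\<^sup>2" "1 \<le> (k + 1)\<^sup>2" by (auto simp: power2_eq_square)
  have "refines (pow_code a B) s (6 + ((k + 1) * 7 + 1 + ((k + 1)\<^sup>2 * 5 + 1) + 1))
    (\<lambda>s' _. s' sqr = int ((k + 1)\<^sup>2 - (k + 1)\<^sup>2) \<and> s' tot = int (x * B ^ (k + 1)\<^sup>2) \<and> ?frame s')
    (return_pmf ())"
    unfolding pow_code_def
    apply (rule refines_Assign_Seq)
     apply (rule refines_Assign_Seq)
      apply (rule refines_Assign_Seq)
       apply (rule refines_Seq_det)
         apply (rule 1)
             apply (use assms in auto)[5]
        apply (rule 2)
          apply auto
    done
  then show ?thesis
    by (rule refines_mono) (use le in auto)
qed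

text \<open>Cells 0 to 3 hold the numerators and denominators of \<epsilon> and \<delta>. Adding the
  numerator of \<epsilon> until its denominator is reached takes \<open>E\<close>, the ceiling of 1
  / \<epsilon>, rounds; doubling the numerator of \<delta> takes \<open>m\<close>, the ceiling of
  the binary logarithm of 1 / \<delta>. The result E^2 (m + 1) is the part of the sample count that
  is independent of \<open>k\<close>.\<close>

definition prelude_code :: com where
  "prelude_code =
     (sqr ::= Const 0 ;; odd_cell ::= Const 1 ;; tmp ::= Const 0 ;;
      While (Lt (V tmp) (V 1))
        (tmp ::= Plus (V tmp) (V 0) ;; sqr ::= Plus (V sqr) (V odd_cell) ;;
         odd_cell ::= Plus (V odd_cell) (Const 2)) ;;
      tmp ::= V 2 ;; tot ::= V sqr ;;
      While (Lt (V tmp) (V 3))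
        (tmp ::= Plus (V tmp) (V tmp) ;; tot ::= Plus (V tot) (V sqr)))"

lemma refines_prelude_code:
  assumes "\<And>i. i < E \<Longrightarrow> int i * s 0 < s 1" "s 1 \<le> int E * s 0"
    and "\<And>i. i < m \<Longrightarrow> 2 ^ i * s 2 < s 3" "s 3 \<le> 2 ^ m * s 2"
  shows "refines prelude_code s (E * 7 + m * 5 + 13)
    (\<lambda>s' _. s' tot = int (E\<^sup>2 * (m + 1)) \<and> (\<forall>i\<ge>0. s' i = s i)) (return_pmf ())"
proof -
  let ?frame = "\<lambda>s'. \<forall>i\<ge>0. s' i = s i"
  have 1: "refines (While (Lt (V tmp) (V 1))
        (tmp ::= Plus (V tmp) (V 0) ;; sqr ::= Plus (V sqr) (V odd_cell) ;;
         odd_cell ::= Plus (V odd_cell) (Const 2))) s' (E * 7 + 1)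
    (\<lambda>s' _. s' sqr = int (E\<^sup>2) \<and> s' odd_cell = 2 * int E + 1 \<and> s' tmp = int E * s 0 \<and> ?frame s')
    (return_pmf ())"
    if "s' sqr = 0" "s' odd_cell = 1" "s' tmp = 0" "?frame s'" for s'
    by (rule refines_While_det[where t = 5 and I = "\<lambda>i s'. s' sqr = int (i\<^sup>2) \<and>
        s' odd_cell = 2 * int i + 1 \<and> s' tmp = int i * s 0 \<and> ?frame s'"])
      (use that assms in \<open>auto intro!: refines_Assign_Seq_diff
          refines_Assign simp: power2_eq_square algebra_simps\<close>)
  have 2: "refines (While (Lt (V tmp) (V 3))
        (tmp ::= Plus (V tmp) (V tmp) ;; tot ::= Plus (V tot) (V sqr))) s' (m * 5 + 1)
    (\<lambda>s' _. s' tmp = 2 ^ m * s 2 \<and> s' sqr = int (E\<^sup>2) \<and> s' tot = int (E\<^sup>2 * (m + 1)) \<and> ?frame s')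
    (return_pmf ())"
    if "s' tmp = s 2" "s' sqr = int (E\<^sup>2)" "s' tot = int (E\<^sup>2)" "?frame s'" for s'
    by (rule refines_While_det[where t = 3 and I = "\<lambda>i s'. s' tmp = 2 ^ i * s 2 \<and>
        s' sqr = int (E\<^sup>2) \<and> s' tot = int (E\<^sup>2 * (i + 1)) \<and> ?frame s'"])
      (use that assms in \<open>auto intro!: refines_Assign_Seq_diff
          refines_Assign simp: algebra_simps\<close>)
  have "refines prelude_code s (6 + (E * 7 + 1 + (4 + (m * 5 + 1)) + 1))
    (\<lambda>s' _. s' tmp = 2 ^ m * s 2 \<and> s' sqr = int (E\<^sup>2) \<and> s' tot = int (E\<^sup>2 * (m + 1)) \<and> ?frame s')
    (return_pmf ())"
    unfolding prelude_code_def
    apply (rule refines_Assign_Seq)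
     apply (rule refines_Assign_Seq)
      apply (rule refines_Assign_Seq)
       apply (rule refines_Seq_det)
         apply (rule 1)
            apply simp_all[4]
        apply (rule refines_Assign_Seq)
         apply (rule refines_Assign_Seq)
          apply (rule 2)
             apply auto
    done
  then show ?thesis by (rule refines_mono) auto
qed

section \<open>Searching the sampled elements for a solution\<close>

text \<open>
  One nested loop for each coefficient: cell \<open>z\<close> holds the sum of the terms chosen so far,
  cell \<open>z - 1\<close> the loop counter, and \<open>z - 2\<close> is the \<open>z\<close> of the next loop.
\<close>

primrec check_code :: "int list \<Rightarrow> int \<Rightarrow> com" where
  "check_code [] z = Cond (Eq (V z) (Const 0)) (wgt ::= Const 0) SKIP"
| "check_code (c # cs) z =
     (z - 1 ::= Const 0 ;;
      While (Lt (V (z - 1)) (V 5))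
        (z - 2 ::= Plus (V z) (scale c (Cell (Plus (V 4) (Plus (Const 5) (V (z - 1)))))) ;;
         check_code cs (z - 2) ;;
         z - 1 ::= Plus (V (z - 1)) (Const 1)))"

text \<open>Solvability in the recursive shape of the nested loops: \<open>a\<close> is the sum of
  the terms already chosen, and the right-hand side of the equation enters with negated
  coefficients.\<close>

primrec zero_sum :: "int set \<Rightarrow> int list \<Rightarrow> int \<Rightarrow> bool" where
  "zero_sum X [] a \<longleftrightarrow> a = 0"
| "zero_sum X (c # cs) a \<longleftrightarrow> (\<exists>x\<in>X. zero_sum X cs (a + c * x))"

primrec check_time :: "nat \<Rightarrow> int list \<Rightarrow> nat" where
  "check_time k [] = 2"
| "check_time k (c # cs) = k * (check_time k cs + 6) + 3"

lemma check_time_ge: "2 \<le> check_time k cs"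
  by (cases cs) auto

text \<open>The inner cost is at least 2, so it absorbs the constants 6 and 3, and each nesting
  level costs at most a factor 4 (k + 1).\<close>

lemma check_time_le: "check_time k cs \<le> 2 * (4 * (k + 1)) ^ length cs"
proof (induction cs)
  case (Cons c cs)
  have "check_time k (c # cs) \<le> k * (check_time k cs + 3 * check_time k cs) + 2 * check_time k cs"
    unfolding check_time.simps
    using check_time_ge[of k cs] by (intro add_mono mult_left_mono) auto
  also have "\<dots> \<le> 4 * (k + 1) * check_time k cs" by (simp add: algebra_simps)
  also have "\<dots> \<le> 4 * (k + 1) * (2 * (4 * (k + 1)) ^ length cs)"
    using Cons by (intro mult_left_mono) auto
  finally show ?case by (simp only: length_Cons power_Suc mult_ac)
qed auto

text \<open>The input ends at address \<open>n + 5\<close>; the sampled elements are stored behind it.\<close>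

definition elems :: "nat \<Rightarrow> nat \<Rightarrow> mem \<Rightarrow> int set" where
  "elems n k s = (\<lambda>i. s (int n + 6 + int i)) ` {..<k}"

text \<open>The loops work strictly below \<open>z\<close>, and \<open>z \<le> - 13\<close> keeps
  them off the program variables. As \<open>wgt\<close> is only ever overwritten by 0, an earlier
  rejection survives the check.\<close>

lemma refines_check_code:
  assumes "z \<le> - 13" "s 4 = int n + 1" "s 5 = int k"
  shows "refines (check_code cs z) s (check_time k cs)
    (\<lambda>s' _. s' wgt = (if zero_sum (elems n k s) cs (s z) then 0 else s wgt) \<and>
      (\<forall>i\<ge>z. i \<noteq> wgt \<longrightarrow> s' i = s i)) (return_pmf ())"
  using assms
proof (induction cs arbitrary: z s)
  case Nil
  then show ?case
    by (auto intro!: refines_Cond[where t = 1] refines_Assign refines_SKIP)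
next
  case (Cons c cs)
  let ?x = "\<lambda>i. s (int n + 6 + int i)"
  let ?Z = "zero_sum (elems n k s) cs"
  let ?I = "\<lambda>i s'. s' (z - 1) = int i \<and>
    s' wgt = (if \<exists>j<i. ?Z (s z + c * ?x j) then 0 else s wgt) \<and> (\<forall>i\<ge>z. i \<noteq> wgt \<longrightarrow> s' i = s i)"
  have "refines (check_code (c # cs) z) s (check_time k (c # cs)) (\<lambda>s' _. ?I k s') (return_pmf ())"
    unfolding check_code.simps
  proof (rule refines_Assign_Seq, rule refines_While_det[where n = k and I = ?I and t = "check_time k cs + 4"], goal_cases)
    case (1 i s')
    then have s'[simp]: "s' 4 = int n + 1" "s' 5 = int k" "s' z = s z" "s' (z - 1) = int i"
      and frame: "\<And>j. z \<le> j \<Longrightarrow> j \<noteq> wgt \<Longrightarrow> s' j = s j"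
      using Cons.prems by auto
    define s1 where "s1 = s'(z - 2 := s z + c * ?x i)"
    let ?e = "Plus (V z) (scale c (Cell (Plus (V 4) (Plus (Const 5) (V (z - 1))))))"
    have aval: "aval ?e s' = s z + c * ?x i"
      using Cons.prems frame[of "6 + (int i + int n)"] by (simp add: algebra_simps)
    have s1: "s1 4 = int n + 1" "s1 5 = int k" "elems n k s1 = elems n k s" "s1 (z - 2) = s z + c * ?x i" "s1 wgt = s' wgt"
      using Cons.prems frame by (auto simp: s1_def elems_def)
    have IH: "refines (check_code cs (z - 2)) s1 (check_time k cs) (\<lambda>s2 _. s2 wgt = (if ?Z (s z + c * ?x i) then 0 else s' wgt) \<and>
      (\<forall>i\<ge>z-2. i \<noteq> wgt \<longrightarrow> s2 i = s1 i)) (return_pmf ())"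
      by (rule Cons.IH[of "z - 2" s1, unfolded s1(3-5)]) (use s1 Cons.prems in auto)
    have increment: "refines (z - 1 ::= Plus (V (z - 1)) (Const 1)) s2 1 (\<lambda>s'. \<lambda>_. ?I (Suc i) s') (return_pmf ())"
      if "s2 wgt = (if ?Z (s z + c * ?x i) then 0 else s' wgt) \<and> (\<forall>i\<ge>z-2. i \<noteq> wgt \<longrightarrow> s2 i = s1 i)" for s2
    proof -
      have "s2 (z - 1) = int i" using that Cons.prems by (auto simp: s1_def)
      moreover have "s2 j = s j" if "z \<le> j" "j \<noteq> wgt" for j
        using \<open>s2 wgt = _ \<and> _\<close> that frame[of j] by (auto simp: s1_def)
      moreover have "s2 wgt = (if \<exists>j<Suc i. ?Z (s z + c * ?x j) then 0 else s wgt)"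
        using that 1 by (auto simp: less_Suc_eq)
      ultimately show ?thesis using Cons.prems by (intro refines_Assign) auto
    qed
    have "s'(aval (Const (z - 2)) s' := aval ?e s') = s1" unfolding aval s1_def by simp
    moreover have "refines (check_code cs (z - 2) ;; z - 1 ::= Plus (V (z - 1)) (Const 1)) s1
        (check_time k cs + 2) (\<lambda>s' _. ?I (Suc i) s') (return_pmf ())"
      by (rule refines_Seq_det[OF IH increment]) auto
    ultimately have "refines (z - 2 ::= ?e ;; check_code cs (z - 2) ;; z - 1 ::= Plus (V (z - 1)) (Const 1)) s'
        (check_time k cs + 4) (\<lambda>s' _. ?I (Suc i) s') (return_pmf ())"
      by (intro refines_Assign_Seq[where t = "check_time k cs + 2"]) (simp_all only:)
    then show ?case using 1 by simp
  next
    case (2 s')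
    then show ?case using Cons.prems by auto
  next
    case 3
    then show ?case using Cons.prems by auto
  qed auto
  moreover have "(\<exists>j<k. ?Z (s z + c * ?x j)) \<longleftrightarrow> zero_sum (elems n k s) (c # cs) (s z)"
    by (auto simp: elems_def)
  ultimately show ?case by (elim refines_mono) auto
qed

section \<open>Drawing index lists with fair coins\<close>

definition digit_pmf :: "nat \<Rightarrow> nat pmf" where
  "digit_pmf b = iter_pmf b (\<lambda>x. map_pmf (\<lambda>r. 2 * x + of_bool r) (bernoulli_pmf (1 / 2))) 0"

definition draws :: "nat \<Rightarrow> nat \<Rightarrow> nat list pmf" where
  "draws b k = iter_pmf k (\<lambda>xs. map_pmf (\<lambda>x. xs @ [x]) (digit_pmf b)) []"

text \<open>An increasing list is the canonical enumeration of its set, so each subset is drawn in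
  exactly one accepted order and no correction by a factorial arises.\<close>

definition increasing_below :: "nat \<Rightarrow> nat list \<Rightarrow> bool" where
  "increasing_below n xs \<longleftrightarrow> sorted_wrt (<) xs \<and> set xs \<subseteq> {..<n}"

lemma increasing_below_snoc:
  "increasing_below n (xs @ [x]) \<longleftrightarrow>
     increasing_below n xs \<and> x < n \<and> (xs \<noteq> [] \<longrightarrow> last xs < x)"
proof -
  have "sorted_wrt (<) (xs @ [x]) \<longleftrightarrow> sorted_wrt (<) xs \<and> (xs \<noteq> [] \<longrightarrow> last xs < x)"
  proof (cases xs rule: rev_cases)
    case (snoc ys y)
    then show ?thesis by (fastforce simp: sorted_wrt_append)
  qed auto
  then show ?thesis by (auto simp: increasing_below_def)
qed

text \<open>Cell 4 holds \<open>n + 1\<close>, as the input word consists of \<open>k\<close> and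
  the \<open>n\<close> elements. Comparing \<open>pw\<close> with it ends the loop after
  \<open>b\<close> flips without \<open>b\<close> being computed.\<close>

definition digit_code :: com where
  "digit_code =
     (idx ::= Const 0 ;; pw ::= Const 1 ;;
      While (Lt (V pw) (V 4))
        (Flip (Const coin) ;; idx ::= Plus (Plus (V idx) (V idx)) (V coin) ;;
         pw ::= Plus (V pw) (V pw) ;; wgt ::= Plus (V wgt) (V wgt)))"

lemma refines_digit_code:
  assumes "\<And>j. j < b \<Longrightarrow> 2 ^ j < s 4" "s 4 \<le> 2 ^ b"
  shows "refines digit_code s (b * 9 + 5)
    (\<lambda>s' x. s' idx = int x \<and> s' wgt = s wgt * 2 ^ b \<and>
      (\<forall>i. i \<notin> {idx, pw, wgt, coin} \<longrightarrow> s' i = s i)) (digit_pmf b)"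
proof -
  let ?frame = "\<lambda>s'. \<forall>i. i \<notin> {idx, pw, wgt, coin} \<longrightarrow> s' i = s i"
  let ?I = "\<lambda>i s' x. s' idx = int x \<and> s' pw = 2 ^ i \<and> s' wgt = s wgt * 2 ^ i \<and> ?frame s'"
  have "refines (While (Lt (V pw) (V 4))
        (Flip (Const coin) ;; idx ::= Plus (Plus (V idx) (V idx)) (V coin) ;;
         pw ::= Plus (V pw) (V pw) ;; wgt ::= Plus (V wgt) (V wgt))) s0 (b * 9 + 1)
         (\<lambda>s' x. ?I b s' x) (digit_pmf b)"
    if s0: "?I 0 s0 0" for s0
    unfolding digit_pmf_def
  proof (rule refines_While[where t = 7 and I = ?I], goal_cases)
    case (1 i s' x)
    have "refines (Flip (Const coin) ;; idx ::= Plus (Plus (V idx) (V idx)) (V coin) ;;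
         pw ::= Plus (V pw) (V pw) ;; wgt ::= Plus (V wgt) (V wgt)) s' 7 (?I (Suc i))
       (bind_pmf (bernoulli_pmf (1 / 2)) (\<lambda>r. return_pmf (2 * x + of_bool r)))"
      by (rule refines_Seq[where t = 1 and u = 5 and R = "\<lambda>s'' r. s'' = s'(coin := of_bool r)"])
        (use 1 in \<open>auto intro!: refines_Flip refines_Assign_Seq_diff refines_Assign\<close>)
    then show ?case using 1 assms by (auto simp: map_pmf_def)
  qed (use s0 assms in auto)
  then have "refines digit_code s (b * 9 + 5) (?I b) (digit_pmf b)"
    unfolding digit_code_def by (intro refines_Assign_Seq_diff) auto
  then show ?thesis by (rule refines_mono) auto
qed

text \<open>
  The cell \<open>wgt\<close> starts with 1, is doubled with every coin flip and set to 0 upon rejection.  So an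
  accepted sample adds the number \<open>2 ^ (b * k)\<close> of possible samples to \<open>hits\<close>, which makes
  \<open>hits / tot\<close> the final estimate.  An index that is too large reads an arbitrary cell,
  but then the sample has been rejected.
\<close>

definition sample_code :: "int list \<Rightarrow> com" where
  "sample_code cs =
     (wgt ::= Const 1 ;; prv ::= Const (- 1) ;; pos ::= Const 0 ;;
      While (Lt (V pos) (V 5))
        (digit_code ;;
         Cond (Conj (Lt (V prv) (V idx)) (Lt (Plus (V idx) (Const 1)) (V 4))) SKIP (wgt ::= Const 0) ;;
         prv ::= V idx ;;
         Assign (Plus (V 4) (Plus (Const 5) (V pos))) (Cell (Plus (Const 6) (V idx))) ;;
         pos ::= Plus (V pos) (Const 1)) ;;
      - 13 ::= Const 0 ;;
      check_code cs (- 13) ;;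
      hits ::= Plus (V hits) (V wgt))"

definition sample_time :: "nat \<Rightarrow> nat \<Rightarrow> int list \<Rightarrow> nat" where
  "sample_time b k cs = k * (9 * b + 17) + check_time k cs + 20"

lemma refines_sample_code:
  assumes n: "s 4 = int n + 1" and k: "s 5 = int k"
    and b: "\<And>j. j < b \<Longrightarrow> 2 ^ j < int n + 1" "int n + 1 \<le> 2 ^ b"
  shows "refines (sample_code cs) s (sample_time b k cs)
    (\<lambda>s' xs. s' hits = s hits + 2 ^ (b * k) *
         of_bool (increasing_below n xs \<and> \<not> zero_sum ((\<lambda>j. s (6 + int j)) ` set xs) cs 0) \<and>
       (\<forall>i\<in>{tot, cnt} \<union> {0..<int n + 6}. s' i = s i)) (draws b k)"
proof -
  let ?frame = "\<lambda>s'. \<forall>i\<in>{tot, cnt, hits} \<union> {0..<int n + 6}. s' i = s i"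
  \<comment> \<open>The stored elements are specified only for samples not yet rejected. The start
    value -1 of \<open>prv\<close> lets the first index be 0.\<close>
  let ?I = "\<lambda>i s' xs. length xs = i \<and> s' pos = int i \<and>
    s' wgt = 2 ^ (b * i) * of_bool (increasing_below n xs) \<and>
    s' prv = (if xs = [] then - 1 else int (last xs)) \<and>
    (increasing_below n xs \<longrightarrow> (\<forall>j<i. s' (int n + 6 + int j) = s (6 + int (xs ! j)))) \<and> ?frame s'"
  have loop: "refines (While (Lt (V pos) (V 5))
        (digit_code ;;
         Cond (Conj (Lt (V prv) (V idx)) (Lt (Plus (V idx) (Const 1)) (V 4))) SKIP (wgt ::= Const 0) ;;
         prv ::= V idx ;;
         Assign (Plus (V 4) (Plus (Const 5) (V pos))) (Cell (Plus (Const 6) (V idx))) ;;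
         pos ::= Plus (V pos) (Const 1))) s0 (k * (9 * b + 17) + 1) (?I k) (draws b k)"
    if s0: "?I 0 s0 []" for s0
    unfolding draws_def
  proof (rule refines_While[where t = "9 * b + 15" and I = ?I], goal_cases)
    case (1 i s' xs)
    then have s': "s' 4 = int n + 1" "s' 5 = int k" using n k by auto
    let ?rest = "Cond (Conj (Lt (V prv) (V idx)) (Lt (Plus (V idx) (Const 1)) (V 4))) SKIP (wgt ::= Const 0) ;;
         prv ::= V idx ;;
         Assign (Plus (V 4) (Plus (Const 5) (V pos))) (Cell (Plus (Const 6) (V idx))) ;;
         pos ::= Plus (V pos) (Const 1)"
    let ?R = "\<lambda>s2 x. s2 idx = int x \<and> s2 wgt = s' wgt * 2 ^ b \<and>
      (\<forall>i. i \<notin> {idx, pw, wgt, coin} \<longrightarrow> s2 i = s' i)"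
    have rest: "refines ?rest s2 8 (?I (Suc i)) (return_pmf (xs @ [x]))" if R: "?R s2 x" for s2 x
    proof (rule refines_Seq_det[where t = 2 and u = 5])
      let ?Q = "\<lambda>s3. s3 wgt = 2 ^ (b * Suc i) * of_bool (increasing_below n (xs @ [x])) \<and>
        (\<forall>i. i \<noteq> wgt \<longrightarrow> s3 i = s2 i)"
      have "s2 prv = (if xs = [] then - 1 else int (last xs))" "s2 4 = int n + 1"
        "s2 wgt = 2 ^ (b * Suc i) * of_bool (increasing_below n xs)"
        using R 1 s' by (auto simp: power_add)
      then show "refines (Cond (Conj (Lt (V prv) (V idx)) (Lt (Plus (V idx) (Const 1)) (V 4))) SKIP (wgt ::= Const 0))
         s2 2 (\<lambda>s3 _. ?Q s3) (return_pmf ())"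
        using R
        by (intro refines_Cond[where t = 1])
          (auto intro!: refines_SKIP refines_Assign simp: increasing_below_snoc split: if_splits)
      fix s3 assume Q: "?Q s3"
      have s3: "s3 4 = int n + 1" "s3 pos = int i" "s3 idx = int x" "?frame s3"
        using Q R 1 s' by auto
      have inc: "increasing_below n (xs @ [x]) \<Longrightarrow> s3 (6 + int x) = s (6 + int x)"
        using s3(4) by (auto simp: increasing_below_snoc)
      have old: "increasing_below n (xs @ [x]) \<Longrightarrow> j < i \<Longrightarrow> s3 (int n + 6 + int j) = s (6 + int (xs ! j))" for j
        using Q R 1 by (auto simp: increasing_below_snoc)
      define s4 where "s4 = s3(prv := int x, int n + 6 + int i := s3 (6 + int x), pos := int i + 1)"
      have "refines (prv ::= V idx ;;
         Assign (Plus (V 4) (Plus (Const 5) (V pos))) (Cell (Plus (Const 6) (V idx))) ;;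
         pos ::= Plus (V pos) (Const 1)) s3 5 (\<lambda>s' ys. s' = s4 \<and> ys = xs @ [x]) (return_pmf (xs @ [x]))"
        by (intro refines_Assign_Seq_diff refines_Assign) (simp_all add: s3 s4_def algebra_simps)
      moreover have "?I (Suc i) s4 (xs @ [x])"
      proof (intro conjI impI allI)
        show "s4 (int n + 6 + int j) = s (6 + int ((xs @ [x]) ! j))"
          if "increasing_below n (xs @ [x])" "j < Suc i" for j
          using that inc old[of j] 1 by (auto simp: s4_def nth_append less_Suc_eq)
        show "?frame s4" using s3(4) by (auto simp: s4_def)
      qed (use 1 Q in \<open>auto simp: s4_def\<close>)
      ultimately show "refines (prv ::= V idx ;;
         Assign (Plus (V 4) (Plus (Const 5) (V pos))) (Cell (Plus (Const 6) (V idx))) ;;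
         pos ::= Plus (V pos) (Const 1)) s3 5 (?I (Suc i)) (return_pmf (xs @ [x]))"
        by (elim refines_mono) auto
    qed simp
    have "refines digit_code s' (b * 9 + 5) ?R (digit_pmf b)"
      by (rule refines_digit_code) (use b s' in auto)
    then have "refines (digit_code ;; ?rest) s' (9 * b + 15) (?I (Suc i))
        (bind_pmf (digit_pmf b) (\<lambda>x. return_pmf (xs @ [x])))"
      by (rule refines_Seq[OF _ rest]) simp_all
    then show ?case using 1 s' by (auto simp: map_pmf_def)
  next
    case (2 s' xs)
    then show ?case using k by auto
  qed (use s0 in auto)
  let ?R = "\<lambda>s' xs. s' hits = s hits + 2 ^ (b * k) *
         of_bool (increasing_below n xs \<and> \<not> zero_sum ((\<lambda>j. s (6 + int j)) ` set xs) cs 0) \<and>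
       (\<forall>i\<in>{tot, cnt} \<union> {0..<int n + 6}. s' i = s i)"
  have final: "refines (- 13 ::= Const 0 ;; check_code cs (- 13) ;; hits ::= Plus (V hits) (V wgt))
     s1 (check_time k cs + 4) ?R (return_pmf xs)"
    if I: "?I k s1 xs" for s1 xs
  proof -
    define s2 where "s2 = s1(- 13 := 0)"
    have s2: "s2 4 = int n + 1" "s2 5 = int k" "s2 (- 13) = 0" "s2 hits = s hits"
      "s2 wgt = 2 ^ (b * k) * of_bool (increasing_below n xs)"
      "\<forall>i\<in>{tot, cnt} \<union> {0..<int n + 6}. s2 i = s i"
      using I n k by (auto simp: s2_def)
    have elems: "elems n k s2 = (\<lambda>j. s (6 + int j)) ` set xs" if "increasing_below n xs"
    proof -
      have "elems n k s2 = (\<lambda>j. s (6 + int (xs ! j))) ` {..<k}"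
        unfolding elems_def using that I by (intro image_cong) (auto simp: s2_def)
      also have "\<dots> = (\<lambda>j. s (6 + int j)) ` (\<lambda>j. xs ! j) ` {..<k}" by (simp add: image_image)
      also have "(\<lambda>j. xs ! j) ` {..<k} = set xs" using I by (auto simp: set_conv_nth)
      finally show ?thesis .
    qed
    have "refines (check_code cs (- 13) ;; hits ::= Plus (V hits) (V wgt)) s2 (check_time k cs + 2) ?R (return_pmf xs)"
      by (rule refines_Seq_det[where u = 1, OF refines_check_code[OF _ s2(1,2)]])
        (use s2 elems in \<open>auto intro!: refines_Assign\<close>)
    then show ?thesis by (intro refines_Assign_Seq_diff) (auto simp: s2_def)
  qed
  have *: "refines (sample_code cs) s (6 + (k * (9 * b + 17) + 1 + (check_time k cs + 4) + 1)) ?R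
      (bind_pmf (draws b k) return_pmf)"
    unfolding sample_code_def
    apply (rule refines_Assign_Seq)
     apply (rule refines_Assign_Seq)
      apply (rule refines_Assign_Seq)
       apply (rule refines_Seq)
         apply (rule loop)
         apply (auto simp: increasing_below_def)[1]
        apply (rule final)
        apply assumption
       apply auto
    done
  show ?thesis
    by (rule refines_mono[OF *[unfolded bind_return_pmf']]) (auto simp: sample_time_def)
qed

text \<open>Cells 0 and 1 contain \<epsilon> on input and the estimate on output, hence they are
  overwritten only at the end. The estimate is left as an unreduced fraction, which avoids
  division.\<close>

definition main_code :: "int list \<Rightarrow> nat \<Rightarrow> com" where
  "main_code cs B =
     (prelude_code ;; pow_code 5 B ;; cnt ::= Const 0 ;; hits ::= Const 0 ;;
      While (Lt (V cnt) (V tot))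
        (sample_code cs ;; cnt ::= Plus (V cnt) (Const 1)) ;;
      0 ::= V hits ;; 1 ::= V tot)"

section \<open>Accepted samples as Bernoulli trials\<close>

lemma iter_pmf_binomial:
  assumes "\<And>h. F h = map_pmf (\<lambda>r. h + of_bool r) (bernoulli_pmf p)" "p \<in> {0..1}"
  shows "iter_pmf T F h = map_pmf (\<lambda>x. h + x) (binomial_pmf T p)"
proof (induction T arbitrary: h)
  case 0
  then show ?case using assms(2) by (simp add: binomial_pmf_0)
next
  case (Suc T)
  have "iter_pmf (Suc T) F h =
    bind_pmf (bernoulli_pmf p) (\<lambda>r. map_pmf (\<lambda>x. h + of_bool r + x) (binomial_pmf T p))"
    by (simp add: assms(1) bind_map_pmf Suc)
  also have "\<dots> = map_pmf (\<lambda>x. h + x) (binomial_pmf (Suc T) p)"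
    unfolding binomial_pmf_Suc[OF assms(2)] map_bind_pmf
    by (intro bind_pmf_cong) (auto simp: map_pmf_def bind_assoc_pmf bind_return_pmf add_ac)
  finally show ?case .
qed

lemma bool_pmf_eq_bernoulli:
  fixes M :: "bool pmf"
  shows "M = bernoulli_pmf (pmf M True)"
proof (rule pmf_eqI)
  fix r
  have "(\<Sum>r\<in>UNIV. pmf M r) = 1" by (rule sum_pmf_eq_1) auto
  then have "pmf M False = 1 - pmf M True" by (simp add: UNIV_bool)
  then show "pmf M r = pmf (bernoulli_pmf (pmf M True)) r"
    by (cases r) (auto simp: pmf_le_1)
qed

lemma map_pmf_pred_eq_bernoulli: "map_pmf P M = bernoulli_pmf (measure_pmf.prob M {x. P x})"
proof -
  have "pmf (map_pmf P M) True = measure_pmf.prob M {x. P x}"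
    by (simp add: pmf_map vimage_def)
  then show ?thesis using bool_pmf_eq_bernoulli[of "map_pmf P M"] by simp
qed

section \<open>Free subsets of positive density\<close>

abbreviation signed_coeffs :: "nat list \<Rightarrow> nat list \<Rightarrow> int list" where
  "signed_coeffs as bs \<equiv> map int as @ map (\<lambda>b. - int b) bs"

lemma zero_sum_mono: "zero_sum X cs a \<Longrightarrow> X \<subseteq> Y \<Longrightarrow> zero_sum Y cs a"
  by (induction cs arbitrary: a) auto

lemma zero_sum_iff:
  "zero_sum X cs a \<longleftrightarrow>
     (\<exists>v. length v = length cs \<and> set v \<subseteq> X \<and> a + (\<Sum>i<length cs. cs ! i * v ! i) = 0)"
proof (induction cs arbitrary: a)
  case (Cons c cs)
  have len: "(\<exists>v. length v = length (c # cs) \<and> Q v) \<longleftrightarrow> (\<exists>x v. length v = length cs \<and> Q (x # v))" for Q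
    by (auto simp: length_Suc_conv)
  have "(\<exists>v. length v = length (c # cs) \<and> set v \<subseteq> X \<and> a + (\<Sum>i<length (c # cs). (c # cs) ! i * v ! i) = 0) \<longleftrightarrow>
    (\<exists>x v. length v = length cs \<and> set (x # v) \<subseteq> X \<and>
       a + (\<Sum>i<length (c # cs). (c # cs) ! i * (x # v) ! i) = 0)"
    by (rule len)
  also have "\<dots> \<longleftrightarrow> (\<exists>x\<in>X. \<exists>v. length v = length cs \<and> set v \<subseteq> X \<and>
       a + c * x + (\<Sum>i<length cs. cs ! i * v ! i) = 0)"
    by (auto simp: sum.lessThan_Suc_shift add.assoc simp del: sum.lessThan_Suc)
  finally show ?case using Cons by simp
qed simp

lemma sum_lessThan_add:
  fixes f :: "nat \<Rightarrow> 'a :: comm_monoid_add"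
  shows "(\<Sum>i<m + n. f i) = (\<Sum>i<m. f i) + (\<Sum>i<n. f (m + i))"
  by (induction n) (auto simp: add_ac)

text \<open>Adding up the vanishing class sums would make the sum of all signed coefficients zero,
  but this is the difference of the two coefficient sums.\<close>

lemma not_trivial_solution:
  assumes "sum_list as \<noteq> sum_list bs"
  shows "\<not> trivial_solution (as, bs) v"
proof
  assume "trivial_solution (as, bs) v"
  then obtain P where P: "partition_on {..<length as + length bs} P"
    "\<forall>C\<in>P. (\<Sum>i\<in>C. signed_coeff (as, bs) i) = 0"
    by (auto simp: trivial_solution_def)
  have "(\<Sum>i<length as + length bs. signed_coeff (as, bs) i) = (\<Sum>i\<in>\<Union>P. signed_coeff (as, bs) i)"
    using P(1) by (simp add: partition_on_def)
  also have "\<dots> = (\<Sum>C\<in>P. \<Sum>i\<in>C. signed_coeff (as, bs) i)"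
  proof (rule sum.Union_disjoint[simplified comp_def])
    show "\<forall>C\<in>P. finite C"
      using P(1) by (auto simp: partition_on_def intro: finite_subset[of _ "{..<length as + length bs}"])
    show "\<forall>A\<in>P. \<forall>B\<in>P. A \<noteq> B \<longrightarrow> A \<inter> B = {}"
      using P(1) by (auto simp: partition_on_def disjoint_def)
  qed
  also have "\<dots> = 0" using P(2) by simp
  finally have "int (sum_list as) - int (sum_list bs) = 0"
    by (simp add: sum_lessThan_add sum_negf sum_list_sum_nth atLeast0LessThan)
  then show False using assms by simp
qed

lemma eq_free_iff:
  assumes "sum_list as \<noteq> sum_list bs"
  shows "eq_free (as, bs) S \<longleftrightarrow> \<not> zero_sum S (signed_coeffs as bs) 0"
proof -
  have "is_solution (as, bs) v \<longleftrightarrow> length v = length (signed_coeffs as bs) \<and>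
    0 + (\<Sum>i<length (signed_coeffs as bs). signed_coeffs as bs ! i * v ! i) = 0" for v
    by (auto simp: sum_lessThan_add nth_append sum_negf)
  then show ?thesis
    using not_trivial_solution[OF assms] unfolding eq_free_def zero_sum_iff by blast
qed

text \<open>Replacing each chosen \<open>x\<close> by the residue of \<open>r * x\<close> changes
  the combination by a multiple of \<open>q\<close> only. The witness \<open>u\<close> is the signed
  combination of these residues, and its range comes from putting all of them at the ends of the
  interval.\<close>

lemma zero_sum_signed_coeffs_residues:
  fixes lo hi q r :: int
  assumes res: "\<And>x. x \<in> S \<Longrightarrow> (r * x) mod q \<in> {lo..hi}" and "zero_sum S (signed_coeffs as bs) a"
  shows "\<exists>u. q dvd r * a + u \<and> u \<in> {int (sum_list as) * lo - int (sum_list bs) * hi ..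
    int (sum_list as) * hi - int (sum_list bs) * lo}"
  using assms(2)
proof (induction as arbitrary: a)
  case Nil
  then show ?case
  proof (induction bs arbitrary: a)
    case (Cons b bs)
    then obtain x where x: "x \<in> S" "zero_sum S (signed_coeffs [] bs) (a - int b * x)" by auto
    obtain u where u: "q dvd r * (a - int b * x) + u"
      "u \<in> {- int (sum_list bs) * hi .. - int (sum_list bs) * lo}"
      using Cons.IH[OF x(2)] by auto
    let ?y = "(r * x) mod q"
    have "q dvd r * x - ?y" by (simp add: minus_mod_eq_mult_div)
    from this have "q dvd (r * (a - int b * x) + u) + int b * (r * x - ?y)"
      by (rule dvd_add[OF u(1) dvd_mult])
    then have "q dvd r * a + (u - int b * ?y)" by (simp add: algebra_simps)
    moreover have "int b * lo \<le> int b * ?y" "int b * ?y \<le> int b * hi"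
      using res[OF x(1)] by (auto intro!: mult_left_mono)
    ultimately show ?case using u(2)
      by (intro exI[of _ "u - int b * ?y"]) (auto simp: algebra_simps)
  qed auto
next
  case (Cons c as)
  then obtain x where x: "x \<in> S" "zero_sum S (signed_coeffs as bs) (a + int c * x)" by auto
  obtain u where u: "q dvd r * (a + int c * x) + u"
    "u \<in> {int (sum_list as) * lo - int (sum_list bs) * hi ..
    int (sum_list as) * hi - int (sum_list bs) * lo}"
    using Cons.IH[OF x(2)] by auto
  let ?y = "(r * x) mod q"
  have "q dvd r * x - ?y" by (simp add: minus_mod_eq_mult_div)
  then have "q dvd (r * (a + int c * x) + u) - int c * (r * x - ?y)"
    by (rule dvd_diff[OF u(1) dvd_mult])
  then have "q dvd r * a + (u + int c * ?y)" by (simp add: algebra_simps)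
  moreover have "int c * lo \<le> int c * ?y" "int c * ?y \<le> int c * hi"
    using res[OF x(1)] by (auto intro!: mult_left_mono)
  ultimately show ?case using u(2)
    by (intro exI[of _ "u + int c * ?y"]) (auto simp: algebra_simps)
qed

text \<open>
  If all entries of a solution have residues in \<open>{lo..hi}\<close> modulo \<open>q\<close>, then neither side of the
  equation wraps around, and the side with the larger coefficient sum is the larger one.
\<close>

lemma not_zero_sum_residues:
  fixes q r lo hi :: int
  assumes res: "\<And>x. x \<in> S \<Longrightarrow> (r * x) mod q \<in> {lo..hi}"
    and ne: "sum_list as \<noteq> sum_list bs" and M: "M = max (sum_list as) (sum_list bs)"
    and "0 < lo" "lo \<le> hi" "int M * hi < q" "(int M - 1) * hi < int M * lo"
  shows "\<not> zero_sum S (signed_coeffs as bs) 0"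
proof
  assume "zero_sum S (signed_coeffs as bs) 0"
  from zero_sum_signed_coeffs_residues[OF res this]
  obtain u where u: "q dvd u" "int (sum_list as) * lo - int (sum_list bs) * hi \<le> u"
    "u \<le> int (sum_list as) * hi - int (sum_list bs) * lo"
    by auto
  show False
  proof (cases "sum_list as < sum_list bs")
    case True
    then have sums: "int (sum_list as) \<le> int M - 1" "int (sum_list bs) = int M"
      using assms by auto
    have "int (sum_list as) * hi \<le> (int M - 1) * hi"
      using sums(1) assms by (intro mult_right_mono) auto
    moreover have "0 \<le> int (sum_list as) * lo" using assms by simp
    ultimately have "u < 0" "- q < u" using u(2,3) assms(6,7) unfolding sums(2) by linarith+
    then show False using u(1) zdvd_imp_le[of q "- u"] by simp
  next
    case False
    then have sums: "int (sum_list bs) \<le> int M - 1" "int (sum_list as) = int M"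
      using assms by auto
    have "int (sum_list bs) * hi \<le> (int M - 1) * hi"
      using sums(1) assms by (intro mult_right_mono) auto
    moreover have "0 \<le> int (sum_list bs) * lo" using assms by simp
    ultimately have "0 < u" "u < q" using u(2,3) assms(6,7) unfolding sums(2) by linarith+
    then show False using u(1) zdvd_imp_le[of q u] by simp
  qed
qed

text \<open>First moment over \<open>r\<close> in {1..q - 1}: each \<open>x\<close> is invertible
  modulo \<open>q\<close>, so at least \<open>card I\<close> multipliers move it into
  \<open>I\<close>. If every \<open>r\<close> stayed below the average, double counting the pairs
  would give a contradiction.\<close>

lemma exists_prime_dilation:
  fixes A I :: "int set"
  assumes "finite A" "prime q" "\<And>x. x \<in> A \<Longrightarrow> \<not> int q dvd x" "I \<subseteq> {1..<int q}"
  shows "\<exists>r. card A * card I \<le> card {x \<in> A. (r * x) mod int q \<in> I} * (q - 1)"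
proof (rule ccontr)
  assume "\<not> ?thesis"
  then have less: "card {x \<in> A. (r * x) mod int q \<in> I} * (q - 1) < card A * card I" for r
    by (meson not_le)
  let ?R = "{1..<int q}"
  have q: "1 < q" using assms(2) by (rule prime_gt_1_nat)
  have "card I \<le> card {r \<in> ?R. (r * x) mod int q \<in> I}" if "x \<in> A" for x
  proof -
    have "coprime (int q) x"
      using assms(2) assms(3)[OF that] by (intro prime_imp_coprime) auto
    then obtain z where z: "[x * z = 1] (mod int q)"
      using cong_solve_coprime_int[of x "int q"] by (auto simp: coprime_commute)
    have "y \<in> (\<lambda>r. (r * x) mod int q) ` {r \<in> ?R. (r * x) mod int q \<in> I}" if y: "y \<in> I" for y
    proof
      \<comment> \<open>With \<open>z\<close> the inverse of \<open>x\<close>, this is the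
        multiplier taking \<open>x\<close> to \<open>y\<close>.\<close>
      let ?r = "(z * y) mod int q"
      have "[?r * x = y * (x * z)] (mod int q)" by (simp add: cong_def mod_mult_left_eq mod_mult_right_eq mult_ac)
      also have "[y * (x * z) = y * 1] (mod int q)" using z by (rule cong_scalar_left)
      finally have "(?r * x) mod int q = y mod int q" by (simp add: cong_def)
      also have "\<dots> = y" using y assms(4) by (intro mod_pos_pos_trivial) auto
      finally show ry: "y = (?r * x) mod int q" by simp
      have "0 \<le> ?r" "?r < int q" using q by auto
      moreover have "?r \<noteq> 0"
      proof
        assume "?r = 0"
        then have "y = 0" using ry by simp
        then show False using y assms(4) by auto
      qed
      ultimately show "?r \<in> {r \<in> ?R. (r * x) mod int q \<in> I}" using ry y by auto
    qed
    then have "I \<subseteq> (\<lambda>r. (r * x) mod int q) ` {r \<in> ?R. (r * x) mod int q \<in> I}" by blast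
    then show ?thesis
      by (rule surj_card_le[rotated]) (auto intro: finite_subset[of _ "{1..<int q}"])
  qed
  then have "card A * card I \<le> (\<Sum>x\<in>A. card {r \<in> ?R. (r * x) mod int q \<in> I})"
    using sum_bounded_below[of A "card I"] by simp
  also have "\<dots> = (\<Sum>r\<in>?R. card {x \<in> A. (r * x) mod int q \<in> I})"
  proof -
    have "(\<Sum>x\<in>A. card {r \<in> ?R. (r * x) mod int q \<in> I}) =
        (\<Sum>x\<in>A. \<Sum>r\<in>?R. of_bool ((r * x) mod int q \<in> I))"
      by (intro sum.cong) (auto simp: Int_def)
    also have "\<dots> = (\<Sum>r\<in>?R. \<Sum>x\<in>A. of_bool ((r * x) mod int q \<in> I))" by (rule sum.swap)
    also have "\<dots> = (\<Sum>r\<in>?R. card {x \<in> A. (r * x) mod int q \<in> I})"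
      using assms(1) by (intro sum.cong) (auto simp: Int_def)
    finally show ?thesis .
  qed
  finally have le: "card A * card I \<le> (\<Sum>r\<in>?R. card {x \<in> A. (r * x) mod int q \<in> I})" .
  have "(q - 1) * (card A * card I) \<le> (q - 1) * (\<Sum>r\<in>?R. card {x \<in> A. (r * x) mod int q \<in> I})"
    using le by (rule mult_le_mono2)
  also have "\<dots> = (\<Sum>r\<in>?R. card {x \<in> A. (r * x) mod int q \<in> I} * (q - 1))"
    unfolding sum_distrib_left by (intro sum.cong refl mult.commute)
  also have "\<dots> < (\<Sum>r\<in>?R. card A * card I)"
    using less q by (intro sum_strict_mono) auto
  also have "\<dots> = (q - 1) * (card A * card I)"
  proof -
    have "nat (int q - 1) = q - 1" by arith
    then show ?thesis by simp
  qed
  finally show False by simp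
qed

lemma exists_dense_free_subset:
  fixes A :: "int set"
  assumes "finite A" "0 \<notin> A" and ne: "sum_list as \<noteq> sum_list bs"
    and M: "M = max (sum_list as) (sum_list bs)"
  shows "\<exists>S\<subseteq>A. card A \<le> 2 * M\<^sup>2 * card S \<and> \<not> zero_sum S (signed_coeffs as bs) 0"
proof -
  have "0 < M" using ne M by (auto simp: max_def)
  \<comment> \<open>Exceeding the sum of absolute values keeps \<open>q\<close> from dividing an
    element of \<open>A\<close>; exceeding \<open>2 * M\<close> pays for rounding, so that
    \<open>q - 1 \<le> 2 * (M * hi)\<close>.\<close>
  obtain q where q: "prime q" "nat (\<Sum>x\<in>A. \<bar>x\<bar>) + 2 * M < q"
    using bigger_prime by blast
  have "\<bar>x\<bar> < int q" if "x \<in> A" for x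
    using member_le_sum[OF that, of abs] assms(1) q(2) by simp
  then have ndvd: "\<not> int q dvd x" if "x \<in> A" for x
    using that assms(2) dvd_imp_le_int[of x "int q"] by fastforce
  \<comment> \<open>\<open>hi\<close> is greatest with \<open>M * hi < q\<close>, so nothing wraps
    around, and \<open>t\<close> is greatest with \<open>M * t < hi\<close>, which says that
    \<open>(M - 1) * hi < M * (hi - t)\<close>. The interval is thus as long as
    \<open>not_zero_sum_residues\<close> allows for this \<open>hi\<close>.\<close>
  define hi where "hi = (q - 1) div M"
  define t where "t = (hi - 1) div M"
  have hi: "M * hi \<le> q - 1" "q \<le> M * hi + M" "1 \<le> hi"
  proof -
    have "M * hi + (q - 1) mod M = q - 1" "(q - 1) mod M < M"
      using \<open>0 < M\<close> by (simp_all add: hi_def)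
    then show le: "M * hi \<le> q - 1" "q \<le> M * hi + M" by linarith+
    show "1 \<le> hi" using le(2) q(2) by (cases hi) auto
  qed
  have t: "M * t \<le> hi - 1" "hi \<le> M * (t + 1)"
  proof -
    have "M * t + (hi - 1) mod M = hi - 1" "(hi - 1) mod M < M"
      using \<open>0 < M\<close> by (simp_all add: t_def)
    then show "M * t \<le> hi - 1" "hi \<le> M * (t + 1)" using hi(3) unfolding distrib_left by linarith+
  qed
  have "t \<le> M * t" using \<open>0 < M\<close> by simp
  then have "t < hi" using t(1) hi(3) by linarith
  let ?I = "{int (hi - t)..int hi}"
  have "hi \<le> M * hi" using \<open>0 < M\<close> by simp
  then have "hi < q" using hi(1) q(2) by linarith
  then have "?I \<subseteq> {1..<int q}" using \<open>t < hi\<close> by auto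
  then obtain r where r: "card A * card ?I \<le> card {x \<in> A. (r * x) mod int q \<in> ?I} * (q - 1)"
    using exists_prime_dilation[OF assms(1) q(1) ndvd] by blast
  define S where "S = {x \<in> A. (r * x) mod int q \<in> ?I}"
  have cI: "card ?I = t + 1" using \<open>t < hi\<close> by simp
  have "q - 1 \<le> 2 * (M * hi)" using hi(2) q(2) by linarith
  also have "\<dots> \<le> 2 * (M * (M * (t + 1)))" using t(2) by (intro mult_le_mono2)
  also have "\<dots> = 2 * M\<^sup>2 * card ?I" unfolding cI power2_eq_square by (simp only: mult.assoc)
  finally have "card A * (q - 1) \<le> card A * (2 * M\<^sup>2 * card ?I)" by (rule mult_le_mono2)
  also have "\<dots> = 2 * M\<^sup>2 * (card A * card ?I)" by (simp only: mult_ac)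
  also have "\<dots> \<le> 2 * M\<^sup>2 * (card S * (q - 1))" unfolding S_def using r by (rule mult_le_mono2)
  finally have "card A * (q - 1) \<le> 2 * M\<^sup>2 * card S * (q - 1)" by (simp only: mult.assoc)
  then have "card A \<le> 2 * M\<^sup>2 * card S"
    using prime_gt_1_nat[OF q(1)] by (simp only: mult_le_cancel2)
  moreover have "\<not> zero_sum S (signed_coeffs as bs) 0"
  proof (rule not_zero_sum_residues[OF _ ne M])
    show "(r * x) mod int q \<in> ?I" if "x \<in> S" for x using that by (simp add: S_def)
    have "int (M * hi) < int q" using hi(1) q(2) by linarith
    then show "int M * int hi < int q" by simp
    have "int (M * t) < int hi" using t(1) hi(3) by linarith
    then show "(int M - 1) * int hi < int M * int (hi - t)"
      using \<open>t < hi\<close> by (simp add: of_nat_diff algebra_simps)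
  qed (use \<open>t < hi\<close> in auto)
  moreover have "S \<subseteq> A" by (auto simp: S_def)
  ultimately show ?thesis by (intro exI[of _ S] conjI)
qed

lemma power_le_choose:
  assumes "k \<le> s"
  shows "s ^ k \<le> k ^ k * (s choose k)"
proof (cases "k = 0")
  case False
  have "(real s / real k) ^ k \<le> real (s choose k)"
    using binomial_ge_n_over_k_pow_k[OF assms, where 'a = real] by simp
  then have "real (s ^ k) \<le> real (k ^ k * (s choose k))"
    using False by (simp add: power_divide field_simps)
  then show ?thesis by (simp only: of_nat_le_iff)
qed simp

text \<open>
  With \<open>P = 2 ^ b\<close> the number of sampled values, this is the lower bound on the acceptance probability.
\<close>

lemma density_bound:
  fixes A :: "int set"
  assumes A: "finite A" and ne: "sum_list as \<noteq> sum_list bs"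
    and M: "M = max (sum_list as) (sum_list bs)"
    and P: "P \<le> 2 * (card A + 1)" and pos: "0 < num_eq_free_subsets (as, bs) (A, k)"
  shows "P ^ k \<le> (8 * M\<^sup>2 + 8) ^ (k + 1)\<^sup>2 * num_eq_free_subsets (as, bs) (A, k)"
proof (cases "k = 0")
  case False
  let ?N = "num_eq_free_subsets (as, bs) (A, k)" and ?D = "4 * M\<^sup>2 + 4"
  \<comment> \<open>Every dilation fixes 0, so it is set aside; this accounts for the additive 4 in
    the bound on \<open>P\<close> below.\<close>
  obtain S where S: "S \<subseteq> A - {0}" "card (A - {0}) \<le> 2 * M\<^sup>2 * card S"
    "\<not> zero_sum S (signed_coeffs as bs) 0"
    using exists_dense_free_subset[OF _ _ ne M, of "A - {0}"] A by auto
  define s where "s = card S"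
  have "card A \<le> card (A - {0}) + 1" using A by (cases "0 \<in> A") (auto simp: card_Suc_Diff1)
  then have P': "P \<le> 4 * M\<^sup>2 * s + 4" using P S(2) by (simp add: s_def)
  \<comment> \<open>If \<open>S\<close> has at least \<open>k\<close> elements, its
    \<open>k\<close>-subsets suffice. Otherwise \<open>P\<close> is bounded in terms of
    \<open>M\<close> and \<open>k\<close>, and the single free subset granted by \<open>pos\<close>
    is enough.\<close>
  have "P ^ k \<le> (?D * k) ^ k * ?N"
  proof (cases "k \<le> s")
    case True
    have "{T. T \<subseteq> S \<and> card T = k} \<subseteq> {T. T \<subseteq> A \<and> card T = k \<and> eq_free (as, bs) T}"
      using S(1,3) zero_sum_mono unfolding eq_free_iff[OF ne] by blast
    moreover have "finite {T. T \<subseteq> A \<and> card T = k \<and> eq_free (as, bs) T}"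
      using A by (auto intro: finite_subset[OF _ finite_Pow_iff[THEN iffD2]])
    moreover have "finite S" using S(1) A by (auto intro: finite_subset)
    ultimately have "s choose k \<le> ?N" by (simp add: s_def n_subsets[symmetric] card_mono)
    have "P \<le> ?D * s" using P' True False by (simp add: algebra_simps)
    then have "P ^ k \<le> (?D * s) ^ k" by (rule power_mono) auto
    also have "\<dots> = ?D ^ k * s ^ k" by (rule power_mult_distrib)
    also have "\<dots> \<le> ?D ^ k * (k ^ k * (s choose k))"
      using power_le_choose[OF True] by (rule mult_le_mono2)
    also have "\<dots> \<le> ?D ^ k * (k ^ k * ?N)"
      using \<open>s choose k \<le> ?N\<close> by (intro mult_le_mono2)
    finally show ?thesis by (simp only: power_mult_distrib mult_ac)
  next
    case False
    then have "4 * M\<^sup>2 * s \<le> 4 * M\<^sup>2 * k" by (intro mult_le_mono2) auto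
    then have "P \<le> 4 * M\<^sup>2 * k + 4 * k" using P' \<open>k \<noteq> 0\<close> by linarith
    then have "P \<le> ?D * k" by (simp only: add_mult_distrib)
    then have "P ^ k \<le> (?D * k) ^ k" by (rule power_mono) auto
    also have "\<dots> \<le> (?D * k) ^ k * ?N" using pos by (cases ?N) auto
    finally show ?thesis .
  qed
  \<comment> \<open>Since \<open>k \<le> 2 ^ k\<close>, the factor \<open>?D * k\<close> is at most
    (2 \<open>?D\<close>)^k, and 2 \<open>?D\<close> is the base 8 M^2 + 8; this moves all
    dependence on \<open>k\<close> into an exponent that \<open>pow_code\<close> can
    produce.\<close>
  also have "(?D * k) ^ k \<le> (8 * M\<^sup>2 + 8) ^ (k + 1)\<^sup>2"
  proof -
    have "?D * k \<le> ?D ^ k * 2 ^ k"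
      using False by (intro mult_le_mono self_le_power) (auto intro: less_imp_le)
    also have "\<dots> = (8 * M\<^sup>2 + 8) ^ k" by (simp add: power_mult_distrib[symmetric])
    finally have "(?D * k) ^ k \<le> ((8 * M\<^sup>2 + 8) ^ k) ^ k" by (rule power_mono) auto
    also have "\<dots> \<le> (8 * M\<^sup>2 + 8) ^ (k + 1)\<^sup>2"
      unfolding power_mult[symmetric] by (intro power_increasing) (auto simp: power2_eq_square)
    finally show ?thesis .
  qed
  then have "(?D * k) ^ k * ?N \<le> (8 * M\<^sup>2 + 8) ^ (k + 1)\<^sup>2 * ?N" by (rule mult_le_mono1)
  finally show ?thesis .
qed (use pos in simp)

section \<open>The distribution of the samples\<close>

lemma bind_pmf_of_set_inj:
  assumes "finite A" "A \<noteq> {}" "finite B" "B \<noteq> {}" "inj_on (\<lambda>(a, b). f a b) (A \<times> B)"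
  shows "bind_pmf (pmf_of_set A) (\<lambda>a. map_pmf (f a) (pmf_of_set B)) =
    pmf_of_set ((\<lambda>(a, b). f a b) ` (A \<times> B))"
proof -
  have "bind_pmf (pmf_of_set A) (\<lambda>a. map_pmf (f a) (pmf_of_set B)) =
    map_pmf (\<lambda>(a, b). f a b) (pair_pmf (pmf_of_set A) (pmf_of_set B))"
    by (simp add: pair_pmf_def map_bind_pmf map_pmf_def bind_assoc_pmf bind_return_pmf)
  also have "pair_pmf (pmf_of_set A) (pmf_of_set B) = pmf_of_set (A \<times> B)"
  proof (rule pmf_eqI)
    fix x
    show "pmf (pair_pmf (pmf_of_set A) (pmf_of_set B)) x = pmf (pmf_of_set (A \<times> B)) x"
      using assms(1-4) by (cases x) (simp add: pmf_pair pmf_of_set indicator_def)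
  qed
  finally show ?thesis using assms by (simp add: map_pmf_of_set_inj)
qed

lemma digit_pmf_eq: "digit_pmf b = pmf_of_set {..<2 ^ b}"
proof (induction b)
  case 0
  then show ?case by (simp add: digit_pmf_def lessThan_Suc pmf_of_set_singleton)
next
  case (Suc b)
  let ?f = "\<lambda>(x :: nat, r). 2 * x + of_bool r"
  have "inj ?f" by (auto simp: inj_def of_bool_def split: if_splits; presburger)
  then have inj: "inj_on ?f ({..<2 ^ b} \<times> UNIV)" by (rule inj_on_subset) simp
  have "digit_pmf (Suc b) = bind_pmf (pmf_of_set {..<2 ^ b})
      (\<lambda>x. map_pmf (\<lambda>r. 2 * x + of_bool r) (pmf_of_set UNIV))"
    unfolding digit_pmf_def iter_pmf_Suc_right
    by (simp only: bernoulli_pmf_half_conv_pmf_of_set Suc[unfolded digit_pmf_def, unfolded bernoulli_pmf_half_conv_pmf_of_set])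
  also have "\<dots> = pmf_of_set (?f ` ({..<2 ^ b} \<times> UNIV))"
    using inj by (intro bind_pmf_of_set_inj) (auto simp: lessThan_empty_iff)
  also have "?f ` ({..<2 ^ b} \<times> UNIV) = {..<2 ^ Suc b}"
  proof (intro equalityI subsetI)
    fix y :: nat assume "y \<in> {..<2 ^ Suc b}"
    then have "y = ?f (y div 2, odd y)" "(y div 2, odd y) \<in> {..<2 ^ b} \<times> UNIV"
      by (auto simp: of_bool_def)
    then show "y \<in> ?f ` ({..<2 ^ b} \<times> UNIV)" by (rule image_eqI)
  qed (auto simp: of_bool_def split: if_splits)
  finally show ?case .
qed

lemma draws_eq: "draws b k = pmf_of_set {xs. set xs \<subseteq> {..<2 ^ b} \<and> length xs = k}"
proof (induction k)
  case 0
  have "{xs :: nat list. set xs \<subseteq> {..<2 ^ b} \<and> length xs = 0} = {[]}" by auto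
  then show ?case by (simp add: draws_def pmf_of_set_singleton)
next
  case (Suc k)
  let ?L = "\<lambda>k. {xs :: nat list. set xs \<subseteq> {..<2 ^ b} \<and> length xs = k}"
  have "draws b (Suc k) = bind_pmf (draws b k) (\<lambda>xs. map_pmf (\<lambda>x. xs @ [x]) (digit_pmf b))"
    by (simp only: draws_def iter_pmf_Suc_right)
  also have "\<dots> = pmf_of_set ((\<lambda>(xs, x). xs @ [x]) ` (?L k \<times> {..<2 ^ b}))"
    unfolding Suc digit_pmf_eq
  proof (intro bind_pmf_of_set_inj)
    have "replicate k 0 \<in> ?L k" by auto
    then show "?L k \<noteq> {}" by blast
  qed (auto simp: finite_lists_length_eq inj_on_def lessThan_empty_iff)
  also have "(\<lambda>(xs, x). xs @ [x]) ` (?L k \<times> {..<2 ^ b}) = ?L (Suc k)"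
  proof (intro equalityI subsetI)
    fix xs assume xs: "xs \<in> ?L (Suc k)"
    then have "xs \<noteq> []" by auto
    then have "xs = (\<lambda>(xs, x). xs @ [x]) (butlast xs, last xs)" by simp
    moreover have "(butlast xs, last xs) \<in> ?L k \<times> {..<2 ^ b}"
      using xs \<open>xs \<noteq> []\<close> by (auto dest: in_set_butlastD last_in_set)
    ultimately show "xs \<in> (\<lambda>(xs, x). xs @ [x]) ` (?L k \<times> {..<2 ^ b})" by (rule image_eqI)
  qed auto
  finally show ?case .
qed

text \<open>Taking the set of selected elements is a bijection from the accepted lists to the sets
  counted, with inverse \<open>sorted_list_of_set\<close>. By \<open>n \<le> 2 ^ b\<close> every
  subset can be drawn.\<close>

lemma prob_draws:
  fixes e :: "nat \<Rightarrow> 'a"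
  assumes "inj_on e {..<n}" "n \<le> 2 ^ b"
  shows "measure_pmf.prob (draws b k) {xs. increasing_below n xs \<and> G (e ` set xs)} =
    real (card {S. S \<subseteq> e ` {..<n} \<and> card S = k \<and> G S}) / 2 ^ (b * k)"
proof -
  let ?L = "{xs :: nat list. set xs \<subseteq> {..<2 ^ b} \<and> length xs = k}"
  let ?good = "{xs. increasing_below n xs \<and> G (e ` set xs)}"
  have "replicate k 0 \<in> ?L" by auto
  then have "?L \<noteq> {}" by blast
  moreover have fin: "finite ?L" "card ?L = (2 ^ b) ^ k"
    by (simp_all add: finite_lists_length_eq card_lists_length_eq)
  ultimately have "measure_pmf.prob (draws b k) ?good = real (card (?L \<inter> ?good)) / (2 ^ b) ^ k"
    by (simp add: draws_eq measure_pmf_of_set)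
  also have "card (?L \<inter> ?good) = card {S. S \<subseteq> e ` {..<n} \<and> card S = k \<and> G S}"
  proof (rule bij_betw_same_card[of "\<lambda>xs. e ` set xs"], rule bij_betw_imageI)
    show "inj_on (\<lambda>xs. e ` set xs) (?L \<inter> ?good)"
    proof (rule inj_onI)
      fix xs ys assume *: "xs \<in> ?L \<inter> ?good" "ys \<in> ?L \<inter> ?good" "e ` set xs = e ` set ys"
      then have "set xs = set ys"
        using inj_on_image_eq_iff[OF assms(1)] by (auto simp: increasing_below_def)
      then show "xs = ys" using * by (intro strict_sorted_equal) (auto simp: increasing_below_def)
    qed
    show "(\<lambda>xs. e ` set xs) ` (?L \<inter> ?good) = {S. S \<subseteq> e ` {..<n} \<and> card S = k \<and> G S}"
    proof (intro equalityI subsetI)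
      fix S assume "S \<in> (\<lambda>xs. e ` set xs) ` (?L \<inter> ?good)"
      then obtain xs where xs: "S = e ` set xs" "length xs = k" "increasing_below n xs" "G S" by auto
      then have "card S = card (set xs)"
        using assms(1) by (auto intro: card_image inj_on_subset simp: increasing_below_def)
      also have "\<dots> = k"
        using xs by (simp add: increasing_below_def distinct_card strict_sorted_iff)
      finally show "S \<in> {S. S \<subseteq> e ` {..<n} \<and> card S = k \<and> G S}"
        using xs by (auto simp: increasing_below_def)
    next
      fix S assume "S \<in> {S. S \<subseteq> e ` {..<n} \<and> card S = k \<and> G S}"
      then obtain J where J: "J \<subseteq> {..<n}" "S = e ` J" and S: "card S = k" "G S"
        by (auto simp: subset_image_iff)
      have "finite J" using J(1) by (rule finite_subset) simp
      moreover have "card J = k"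
        using S(1) card_image[OF inj_on_subset[OF assms(1) J(1)]] J(2) by simp
      ultimately have "sorted_list_of_set J \<in> ?L \<inter> ?good" "S = e ` set (sorted_list_of_set J)"
        using J S assms(2) by (auto simp: increasing_below_def)
      then show "S \<in> (\<lambda>xs. e ` set xs) ` (?L \<inter> ?good)" by blast
    qed
  qed
  finally show ?thesis by (simp add: power_mult)
qed

text \<open>A round matters only through whether its sample is accepted, so the machine is coupled
  with the binomial number \<open>h\<close> of acceptances, and \<open>hits\<close> holds
  \<open>h\<close> times the number of possible samples.\<close>

lemma refines_main_code:
  assumes n: "s 4 = int n + 1" and k: "s 5 = int k"
    and b: "\<And>j. j < b \<Longrightarrow> 2 ^ j < int n + 1" "int n + 1 \<le> 2 ^ b"
    and E: "\<And>i. i < E \<Longrightarrow> int i * s 0 < s 1" "s 1 \<le> int E * s 0"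
    and m: "\<And>i. i < m \<Longrightarrow> 2 ^ i * s 2 < s 3" "s 3 \<le> 2 ^ m * s 2"
    and T: "T = E\<^sup>2 * (m + 1) * B ^ (k + 1)\<^sup>2"
    and p: "p = measure_pmf.prob (draws b k) {xs. increasing_below n xs \<and>
      \<not> zero_sum ((\<lambda>j. s (6 + int j)) ` set xs) cs 0}"
  shows "refines (main_code cs B) s
    (7 * E + 5 * m + 21 * (k + 1)\<^sup>2 + T * (sample_time b k cs + 4) + 24)
    (\<lambda>s' h. s' 0 = int h * 2 ^ (b * k) \<and> s' 1 = int T) (binomial_pmf T p)"
proof -
  let ?good = "\<lambda>xs. increasing_below n xs \<and> \<not> zero_sum ((\<lambda>j. s (6 + int j)) ` set xs) cs 0"
  define F where "F h = map_pmf (\<lambda>xs. h + of_bool (?good xs) :: nat) (draws b k)" for h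
  have "F h = map_pmf (\<lambda>r. h + of_bool r) (map_pmf ?good (draws b k))" for h
    by (simp add: F_def pmf.map_comp o_def)
  then have F: "F h = map_pmf (\<lambda>r. h + of_bool r) (bernoulli_pmf p)" for h
    by (simp only: map_pmf_pred_eq_bernoulli p)
  have "p \<in> {0..1}" unfolding p by auto
  have binomial: "iter_pmf T F 0 = binomial_pmf T p"
    using iter_pmf_binomial[of F p T 0, OF F \<open>p \<in> {0..1}\<close>] by simp
  let ?frame = "\<lambda>s'. \<forall>i\<in>{0..<int n + 6}. s' i = s i"
  let ?I = "\<lambda>i s' h. s' cnt = int i \<and> s' tot = int T \<and> s' hits = int h * 2 ^ (b * k) \<and> ?frame s'"
  have loop: "refines (While (Lt (V cnt) (V tot)) (sample_code cs ;; cnt ::= Plus (V cnt) (Const 1)))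
      s0 (T * (sample_time b k cs + 4) + 1) (?I T) (binomial_pmf T p)" if s0: "?I 0 s0 0" for s0
    unfolding binomial[symmetric]
  proof (rule refines_While[where t = "sample_time b k cs + 2" and I = ?I], goal_cases)
    case (1 i s' h)
    have s': "s' 4 = int n + 1" "s' 5 = int k" using 1 n k by auto
    \<comment> \<open>Later rounds read the elements in their own memory \<open>s'\<close>. The
      input cells are intact, so acceptance is the same predicate in every round.\<close>
    have img: "(\<lambda>j. s' (6 + int j)) ` set xs = (\<lambda>j. s (6 + int j)) ` set xs" if "increasing_below n xs" for xs
      using that 1 by (intro image_cong) (auto simp: increasing_below_def)
    have good: "increasing_below n xs \<and> \<not> zero_sum ((\<lambda>j. s' (6 + int j)) ` set xs) cs 0 \<longleftrightarrow> ?good xs" for xs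
      using img by auto
    have "refines (sample_code cs ;; cnt ::= Plus (V cnt) (Const 1)) s' (sample_time b k cs + 2)
      (?I (Suc i)) (bind_pmf (draws b k) (\<lambda>xs. return_pmf (h + of_bool (?good xs))))"
      by (rule refines_Seq[where u = 1, OF refines_sample_code[where cs = cs, OF s' b, unfolded good]])
        (use 1 in \<open>auto intro!: refines_Assign simp: algebra_simps\<close>)
    then show ?case using 1 by (simp add: F_def map_pmf_def)
  qed (use s0 in \<open>auto simp: algebra_simps\<close>)
  have *: "refines (main_code cs B) s
    (E * 7 + m * 5 + 13 + (21 * (k + 1)\<^sup>2 + (4 + (T * (sample_time b k cs + 4) + 1 + 3 + 1)) + 1) + 1)
    (\<lambda>s' h. s' 0 = int h * 2 ^ (b * k) \<and> s' 1 = int T) (bind_pmf (binomial_pmf T p) return_pmf)"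
    unfolding main_code_def
  proof (rule refines_Seq_det[OF refines_prelude_code[OF E m]], assumption, assumption)
    fix s1 assume s1: "s1 tot = int (E\<^sup>2 * (m + 1)) \<and> (\<forall>i\<ge>0. s1 i = s i)"
    then have "s1 5 = int k" using k by simp
    show "refines (pow_code 5 B ;; cnt ::= Const 0 ;; hits ::= Const 0 ;;
        While (Lt (V cnt) (V tot)) (sample_code cs ;; cnt ::= Plus (V cnt) (Const 1)) ;;
        0 ::= V hits ;; 1 ::= V tot) s1
      (21 * (k + 1)\<^sup>2 + (4 + (T * (sample_time b k cs + 4) + 1 + 3 + 1)) + 1)
      (\<lambda>s' h. s' 0 = int h * 2 ^ (b * k) \<and> s' 1 = int T) (bind_pmf (binomial_pmf T p) return_pmf)"
    proof (rule refines_Seq_det[OF refines_pow_code[OF _ \<open>s1 5 = int k\<close> conjunct1[OF s1]]])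
      fix s2 assume s2: "s2 tot = int (E\<^sup>2 * (m + 1) * B ^ (k + 1)\<^sup>2) \<and>
        (\<forall>i. i \<notin> {sqr, odd_cell, cnt, tot} \<longrightarrow> s2 i = s1 i)"
      show "refines (cnt ::= Const 0 ;; hits ::= Const 0 ;;
        While (Lt (V cnt) (V tot)) (sample_code cs ;; cnt ::= Plus (V cnt) (Const 1)) ;;
        0 ::= V hits ;; 1 ::= V tot) s2 (4 + (T * (sample_time b k cs + 4) + 1 + 3 + 1))
        (\<lambda>s' h. s' 0 = int h * 2 ^ (b * k) \<and> s' 1 = int T) (bind_pmf (binomial_pmf T p) return_pmf)"
        apply (rule refines_Assign_Seq)
         apply (rule refines_Assign_Seq)
          apply (rule refines_Seq[where u = 3])
            apply (rule loop)
        subgoal using s1 s2 T by auto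
           apply (auto intro!: refines_Assign_Seq_diff refines_Assign)
        done
    qed auto
  qed auto
  show ?thesis
    by (rule refines_mono[OF *[unfolded bind_return_pmf']]) auto
qed

text \<open>The factor of the time bound that depends on \<open>k\<close> has the same shape as the
  factor of the sample count, so \<open>pow_code\<close> computes it too.\<close>

lemma computable_power_square: "computable (\<lambda>k. D ^ (k + 1)\<^sup>2)"
proof -
  let ?c = "tot ::= Const 1 ;; pow_code 0 D ;; 0 ::= V tot"
  have "\<exists>t s. run t (?c, load [int k]) = return_pmf (SKIP, s) \<and> s 0 = int (D ^ (k + 1)\<^sup>2)" for k
  proof -
    let ?s = "(load [int k])(tot := 1)"
    have "refines (pow_code 0 D ;; 0 ::= V tot) ?s (21 * (k + 1)\<^sup>2 + 1 + 1)
      (\<lambda>s _. s 0 = int (D ^ (k + 1)\<^sup>2)) (return_pmf ())"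
      by (rule refines_Seq_det[OF refines_pow_code[where k = k and x = 1]])
        (auto simp: load_def intro!: refines_Assign)
    then have "refines ?c (load [int k]) (21 * (k + 1)\<^sup>2 + 1 + 1 + 2)
      (\<lambda>s _. s 0 = int (D ^ (k + 1)\<^sup>2)) (return_pmf ())"
      by (intro refines_Assign_Seq) auto
    from refines_flip_free[OF _ this] show ?thesis
      by (intro exI[of _ "21 * (k + 1)\<^sup>2 + 1 + 1 + 2"]) (simp add: flip_free_pow_code)
  qed
  then show ?thesis unfolding computable_def by blast
qed

section \<open>Error probability and running time\<close>

text \<open>For positive \<open>p\<close>, Hoeffding bounds the failure probability by 2 exp(- 2 T
  (\<epsilon> p)^2). The exponential is at most exp(- (m + 1)), hence at most 2^(- (m + 1)), and the
  extra 1 compensates the leading 2. For \<open>p = 0\<close> the count is always 0, which is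
  exact.\<close>

lemma binomial_relative_error:
  fixes p \<epsilon> \<delta> :: real
  assumes p: "0 \<le> p" "p \<le> 1" and \<epsilon>: "0 < \<epsilon>" and T: "0 < T"
    and m: "0 < p \<Longrightarrow> real m + 1 \<le> real T * (\<epsilon> * p)\<^sup>2" and \<delta>: "1 \<le> 2 ^ m * \<delta>"
  shows "1 - \<delta> \<le> measure_pmf.prob (binomial_pmf T p) {x. \<bar>real x / real T - p\<bar> \<le> \<epsilon> * p}"
proof (cases "p = 0")
  case True
  have "0 < \<delta>"
  proof (rule ccontr)
    assume "\<not> 0 < \<delta>"
    then have "2 ^ m * \<delta> \<le> 0" by (simp add: mult_le_0_iff)
    then show False using \<delta> by linarith
  qed
  moreover have "measure_pmf.prob (binomial_pmf T p) {x. \<bar>real x / real T - p\<bar> \<le> \<epsilon> * p} = 1"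
    using True by (subst measure_pmf.prob_eq_1) (auto simp: AE_measure_pmf_iff)
  ultimately show ?thesis by simp
next
  case False
  interpret binomial_distribution T p by unfold_locales (use p in auto)
  let ?bad = "{x :: nat. \<epsilon> * p \<le> \<bar>real x / real T - p\<bar>}"
  have "real m + 1 \<le> 2 * real T * (\<epsilon> * p)\<^sup>2"
  proof -
    have "0 \<le> real T * (\<epsilon> * p)\<^sup>2" by simp
    moreover have "real m + 1 \<le> real T * (\<epsilon> * p)\<^sup>2" using m False p by simp
    ultimately show ?thesis by linarith
  qed
  then have "exp (- 2 * real T * (\<epsilon> * p)\<^sup>2) \<le> exp (- 1 * real (Suc m))" by simp
  also have "\<dots> = exp (- 1) ^ Suc m" by (rule exp_of_nat2_mult)
  also have "\<dots> \<le> (1 / 2) ^ Suc m"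
    using exp_ge_add_one_self[of 1] by (intro power_mono) (auto simp: exp_minus field_simps)
  also have "\<dots> \<le> \<delta> / 2" using \<delta> by (simp add: field_simps)
  finally have "measure_pmf.prob (binomial_pmf T p) ?bad \<le> \<delta>"
    using prob_abs_ge'[OF T, of "\<epsilon> * p"] \<epsilon> p by simp
  moreover have "measure_pmf.prob (binomial_pmf T p) (UNIV - ?bad) = 1 - measure_pmf.prob (binomial_pmf T p) ?bad"
    using measure_pmf.prob_compl[of ?bad "binomial_pmf T p"] by simp
  moreover have "measure_pmf.prob (binomial_pmf T p) (UNIV - ?bad) \<le>
      measure_pmf.prob (binomial_pmf T p) {x. \<bar>real x / real T - p\<bar> \<le> \<epsilon> * p}"
    by (rule measure_pmf.finite_measure_mono) auto
  ultimately show ?thesis by linarith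
qed

lemma good_outputI:
  assumes "s 0 = int h * 2 ^ e" "s 1 = int T" "0 < T" "real N = p * 2 ^ e"
    and "\<bar>real h / real T - p\<bar> \<le> real_of_rat \<epsilon> * p"
  shows "good_output \<epsilon> N s"
proof -
  have "Fract (s 0) (s 1) = of_nat h * 2 ^ e / of_nat T"
    using assms(1-3) by (simp add: Fract_of_int_quotient)
  then have F: "real_of_rat (Fract (s 0) (s 1)) = real h / real T * 2 ^ e"
    by (simp add: of_rat_divide of_rat_mult of_rat_power)
  have "(p - real_of_rat \<epsilon> * p) * 2 ^ e \<le> real h / real T * 2 ^ e"
    "real h / real T * 2 ^ e \<le> (p + real_of_rat \<epsilon> * p) * 2 ^ e"
    using assms(5) by (intro mult_right_mono; simp add: abs_le_iff)+
  then have "real_of_rat ((1 - \<epsilon>) * of_nat N) \<le> real_of_rat (Fract (s 0) (s 1))"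
    "real_of_rat (Fract (s 0) (s 1)) \<le> real_of_rat ((1 + \<epsilon>) * of_nat N)"
    unfolding F of_rat_mult of_rat_add of_rat_diff of_rat_of_nat_eq of_rat_1 assms(4)
    by (simp_all add: algebra_simps)
  then show ?thesis using assms(2,3) by (simp add: good_output_def of_rat_less_eq)
qed

lemma refines_prob:
  assumes "refines c s t R M" "\<And>s' a. R s' a \<Longrightarrow> a \<in> X \<Longrightarrow> P s'"
  shows "measure_pmf.prob M X \<le> measure_pmf.prob (run t (c, s)) {(c, s'). P s'}"
proof -
  have "rel_pmf (\<lambda>a (c', s'). c' = SKIP \<and> R s' a) M (run t (c, s))"
    using assms(1) unfolding refines_def
    by (subst pmf.rel_flip[symmetric]) (simp add: conversep_iff[abs_def] case_prod_unfold)
  then have "measure_pmf.prob M X \<le>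
      measure_pmf.prob (run t (c, s)) {y. \<exists>a\<in>X. (\<lambda>a (c', s'). c' = SKIP \<and> R s' a) a y}"
    by (rule rel_pmf_measureD)
  also have "\<dots> \<le> measure_pmf.prob (run t (c, s)) {(c, s'). P s'}"
    using assms(2) by (intro measure_pmf.finite_measure_mono) auto
  finally show ?thesis .
qed

text \<open>\<open>2 ^ b \<le> 2 * (n + 1)\<close> keeps the acceptance probability from decaying
  with \<open>n\<close>. The crude \<open>b \<le> n + 1\<close> is good enough for the running
  time.\<close>

lemma ex_doubling_count:
  "\<exists>b. (\<forall>j<b. 2 ^ j < int n + 1) \<and> int n + 1 \<le> 2 ^ b \<and> 2 ^ b \<le> 2 * (n + 1) \<and> b \<le> n + 1"
proof -
  have ex: "n + 1 \<le> (2 :: nat) ^ (n + 1)" by (rule less_imp_le, rule less_exp)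
  define b where "b = (LEAST b. n + 1 \<le> (2 :: nat) ^ b)"
  have b: "n + 1 \<le> 2 ^ b" unfolding b_def by (rule LeastI) (rule ex)
  have less: "2 ^ j < n + 1" if "j < b" for j
    using not_less_Least[OF that[unfolded b_def]] by simp
  have "2 ^ b \<le> 2 * (n + 1)"
  proof (cases b)
    case (Suc j)
    then show ?thesis using less[of j] by simp
  qed simp
  moreover have "b \<le> n + 1" unfolding b_def by (rule Least_le) (rule ex)
  moreover have "2 ^ j < int n + 1" if "j < b" for j
  proof -
    have "int (2 ^ j) < int (n + 1)" using less[OF that] by (simp only: of_nat_less_iff)
    then show ?thesis by (simp only: of_nat_add of_nat_1 of_nat_power of_nat_numeral)
  qed
  moreover have "int (n + 1) \<le> int (2 ^ b)" using b by (simp only: of_nat_le_iff)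
  ultimately show ?thesis by (intro exI[of _ b]) auto
qed

text \<open>The integer inequalities are the loop conditions of \<open>prelude_code\<close>; the
  real ones serve the error and time estimates.\<close>

lemma ex_multiple_count:
  fixes \<epsilon> :: rat
  assumes "0 < \<epsilon>" "quotient_of \<epsilon> = (a, d)"
  shows "\<exists>E. (\<forall>i<E. int i * a < d) \<and> d \<le> int E * a \<and> 1 \<le> E \<and> 1 \<le> real E * real_of_rat \<epsilon> \<and>
    real E \<le> 1 / real_of_rat \<epsilon> + 1"
proof -
  have d: "0 < d" using assms(2) by (rule quotient_of_denom_pos)
  have \<epsilon>: "real_of_rat \<epsilon> = real_of_int a / real_of_int d"
    using quotient_of_div[OF assms(2)] by (simp add: of_rat_divide)
  moreover have "0 < real_of_rat \<epsilon>" using assms(1) by simp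
  ultimately have a: "0 < a" using d by (simp add: zero_less_divide_iff)
  define E where "E = nat \<lceil>1 / real_of_rat \<epsilon>\<rceil>"
  have E: "1 / real_of_rat \<epsilon> \<le> real E" "real E < 1 / real_of_rat \<epsilon> + 1"
    using \<open>0 < real_of_rat \<epsilon>\<close> unfolding E_def by (auto simp: le_of_int_ceiling ceiling_less_iff, linarith+)
  have "real i < 1 / real_of_rat \<epsilon>" if "i < E" for i
    using that E(2) by linarith
  then have "real_of_int (int i * a) < real_of_int d" if "i < E" for i
    using that a d \<epsilon> by (auto simp: field_simps)
  then have "\<forall>i<E. int i * a < d" by (simp only: of_int_less_iff) blast
  moreover have "real_of_int d \<le> real_of_int (int E * a)"
    using E(1) a d \<epsilon> by (auto simp: field_simps)
  then have "d \<le> int E * a" by (simp only: of_int_le_iff)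
  moreover have "0 < 1 / real_of_rat \<epsilon>" using \<open>0 < real_of_rat \<epsilon>\<close> by simp
  then have "1 \<le> E" using E(1) by (cases E) auto
  moreover have "1 \<le> real E * real_of_rat \<epsilon>"
    using E(1) \<open>0 < real_of_rat \<epsilon>\<close> by (simp add: field_simps)
  ultimately show ?thesis using E(2) by (intro exI[of _ E]) auto
qed

lemma ex_halving_count:
  fixes \<delta> :: rat
  assumes "0 < \<delta>" "\<delta> < 1" "quotient_of \<delta> = (a, d)"
  shows "\<exists>m. (\<forall>i<m. 2 ^ i * a < d) \<and> d \<le> 2 ^ m * a \<and> 1 \<le> 2 ^ m * real_of_rat \<delta> \<and>
    real m \<le> log 2 (1 / real_of_rat \<delta>) + 1"
proof -
  have d: "0 < d" using assms(3) by (rule quotient_of_denom_pos)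
  have \<delta>: "real_of_rat \<delta> = real_of_int a / real_of_int d"
    using quotient_of_div[OF assms(3)] by (simp add: of_rat_divide)
  have pos: "0 < real_of_rat \<delta>" using assms(1) by simp
  then have a: "0 < a" using d \<delta> by (simp add: zero_less_divide_iff)
  have "real_of_rat \<delta> < 1" using assms(2) by simp
  define m where "m = nat \<lceil>log 2 (1 / real_of_rat \<delta>)\<rceil>"
  have "0 \<le> log 2 (1 / real_of_rat \<delta>)" using pos \<open>real_of_rat \<delta> < 1\<close> by (simp add: log_divide)
  then have m: "log 2 (1 / real_of_rat \<delta>) \<le> real m" "real m < log 2 (1 / real_of_rat \<delta>) + 1"
    unfolding m_def by linarith+
  have "1 / real_of_rat \<delta> \<le> 2 powr real m" using m(1) pos by (subst (asm) log_le_iff) auto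
  then have le: "1 / real_of_rat \<delta> \<le> 2 ^ m" by (simp add: powr_realpow)
  have "2 ^ i < 1 / real_of_rat \<delta>" if "i < m" for i
  proof -
    have "real i < log 2 (1 / real_of_rat \<delta>)" using that m(2) by linarith
    then have "2 powr real i < 1 / real_of_rat \<delta>" using pos by (subst (asm) less_log_iff) auto
    then show ?thesis by (simp add: powr_realpow)
  qed
  then have "real_of_int (2 ^ i * a) < real_of_int d" if "i < m" for i
    using that a d \<delta> by (auto simp: field_simps)
  then have "\<forall>i<m. 2 ^ i * a < d" by (simp only: of_int_less_iff) blast
  moreover have "real_of_int d \<le> real_of_int (2 ^ m * a)"
    using le a d \<delta> by (auto simp: field_simps)
  then have "d \<le> 2 ^ m * a" by (simp only: of_int_le_iff)
  moreover have "1 \<le> 2 ^ m * real_of_rat \<delta>"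
    using le pos by (simp add: field_simps)
  ultimately show ?thesis using m(2) by (intro exI[of _ m]) auto
qed

section \<open>The running time bound\<close>

definition time_poly :: "real \<Rightarrow> real \<Rightarrow> real \<Rightarrow> real" where
  "time_poly x y z = 200 * ((x + 1) * (y + 1)\<^sup>2 * (z + 2))"

lemma polynomial3_time_poly: "polynomial3 time_poly"
  unfolding polynomial3_def
proof (intro exI allI)
  fix x y z
  \<comment> \<open>The coefficients of x + 1, (y + 1)^2 and z + 2, padded with zeros to degree
    2.\<close>
  let ?c = "\<lambda>i j l. 200 * ((if i \<le> (1 :: nat) then 1 else 0) * (if j = (1 :: nat) then 2 else 1) *
    (if l = (0 :: nat) then 2 else if l = 1 then 1 else 0)) :: real"
  show "time_poly x y z = (\<Sum>i\<le>2. \<Sum>j\<le>2. \<Sum>l\<le>2. ?c i j l * x ^ i * y ^ j * z ^ l)"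
    by (simp add: time_poly_def numeral_2_eq_2 power2_eq_square algebra_simps)
qed

text \<open>As k + 1 is at most 2^(k + 1), the polynomial cost of the nested loops fits under a
  constant to the power (k + 1)^2 and can be merged with the sample count.\<close>

lemma power_time_bound: "(4 * (k + 1)) ^ l \<le> (8 ^ l) ^ (k + 1)\<^sup>2" for k l :: nat
proof -
  have "k + 1 \<le> 2 ^ (k + 1)" by (rule less_imp_le, rule less_exp)
  moreover have "(4 :: nat) \<le> 4 ^ (k + 1)" using power_increasing[of 1 "k + 1" "4 :: nat"] by simp
  ultimately have "4 * (k + 1) \<le> 4 ^ (k + 1) * 2 ^ (k + 1)" by (rule mult_le_mono[rotated])
  also have "\<dots> = 8 ^ (k + 1)" by (simp only: power_mult_distrib[symmetric]) simp
  also have "\<dots> \<le> 8 ^ (k + 1)\<^sup>2" by (intro power_increasing) (auto simp: power2_eq_square)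
  finally have "(4 * (k + 1)) ^ l \<le> (8 ^ (k + 1)\<^sup>2) ^ l" by (rule power_mono) simp
  also have "\<dots> = (8 ^ l) ^ (k + 1)\<^sup>2" by (simp only: power_mult[symmetric] mult.commute)
  finally show ?thesis .
qed

lemma total_time_le:
  assumes "1 \<le> E" "1 \<le> B" "b \<le> n + 1"
  shows "7 * E + 5 * m + 21 * (k + 1)\<^sup>2 +
      E\<^sup>2 * (m + 1) * B ^ (k + 1)\<^sup>2 * (sample_time b k cs + 4) + 24
    \<le> (B * 8 ^ (length cs + 2)) ^ (k + 1)\<^sup>2 * (200 * ((n + 2) * E\<^sup>2 * (m + 1)))"
proof -
  \<comment> \<open>The two factors beyond \<open>length cs\<close> absorb \<open>k\<close> and
    \<open>(k + 1)\<^sup>2\<close>.\<close>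
  let ?X = "(4 * (k + 1)) ^ (length cs + 2)" and ?W = "B ^ (k + 1)\<^sup>2"
  let ?U = "E\<^sup>2 * (m + 1)"
  have W: "1 \<le> ?W" using assms(2) by simp
  have E: "E \<le> ?U" "m + 1 \<le> ?U" "1 \<le> ?U"
  proof -
    have "1 \<le> E\<^sup>2" "E \<le> E\<^sup>2" using assms(1) by (auto simp: power2_eq_square)
    moreover have "E\<^sup>2 \<le> ?U" by simp
    moreover show "m + 1 \<le> ?U" using mult_le_mono1[OF \<open>1 \<le> E\<^sup>2\<close>, of "m + 1"] by simp
    ultimately show "E \<le> ?U" "1 \<le> ?U" by (blast intro: order.trans)+
  qed
  have X: "(k + 1)\<^sup>2 \<le> ?X" "k \<le> ?X" "(4 * (k + 1)) ^ length cs \<le> ?X" "1 \<le> ?X"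
  proof -
    have "(k + 1)\<^sup>2 \<le> (4 * (k + 1))\<^sup>2" by (intro power_mono) auto
    also have "\<dots> \<le> ?X" by (intro power_increasing) auto
    finally show sq: "(k + 1)\<^sup>2 \<le> ?X" .
    have "k \<le> (k + 1)\<^sup>2" by (simp add: power2_eq_square)
    then show "k \<le> ?X" using sq by linarith
    show "(4 * (k + 1)) ^ length cs \<le> ?X" by (intro power_increasing) auto
    show "1 \<le> ?X" by simp
  qed
  have "sample_time b k cs + 4 \<le> k * (9 * (n + 1) + 17) + 2 * (4 * (k + 1)) ^ length cs + 24"
  proof -
    have "k * (9 * b + 17) \<le> k * (9 * (n + 1) + 17)" using assms(3) by (intro mult_le_mono2) simp
    then show ?thesis unfolding sample_time_def using check_time_le[of k cs] by linarith
  qed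
  also have "\<dots> \<le> ?X * (9 * (n + 1) + 17) + 2 * ?X + 24 * ?X"
    using X by (intro add_mono mult_le_mono) auto
  also have "\<dots> \<le> 52 * ((n + 2) * ?X)" by (simp add: algebra_simps)
  finally have s: "?U * ?W * (sample_time b k cs + 4) \<le> ?U * ?W * (52 * ((n + 2) * ?X))"
    by (rule mult_le_mono2)
  have "7 * E + 5 * m + 21 * (k + 1)\<^sup>2 + 24 \<le> 36 * ?U + 21 * ?X"
    using E X(1) by linarith
  also have "\<dots> \<le> 36 * (?U * ?X) + 21 * (?U * ?X)"
    using E(3) X(4) by (intro add_mono mult_le_mono2) auto
  also have "\<dots> = 57 * (?U * 1 * (1 * ?X))" by simp
  also have "\<dots> \<le> 57 * (?U * ?W * ((n + 2) * ?X))"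
    using W by (intro mult_le_mono) auto
  finally have "7 * E + 5 * m + 21 * (k + 1)\<^sup>2 + ?U * ?W * (sample_time b k cs + 4) + 24
      \<le> 109 * (?U * ?W * ((n + 2) * ?X))"
    using s by linarith
  also have "\<dots> \<le> 200 * (?U * ?W * ((n + 2) * (8 ^ (length cs + 2)) ^ (k + 1)\<^sup>2))"
    by (intro mult_le_mono power_time_bound) auto
  also have "\<dots> = (B * 8 ^ (length cs + 2)) ^ (k + 1)\<^sup>2 * (200 * ((n + 2) * E\<^sup>2 * (m + 1)))"
    by (simp only: power_mult_distrib mult_ac)
  finally show ?thesis .
qed

theorem theorem7p8:
  fixes as bs :: "nat list"
  assumes "as \<noteq> []" and "bs \<noteq> []"
    and "sum_list as \<noteq> sum_list bs"
  shows "admits_FPTRAS encodes_subset_instance snd (num_eq_free_subsets (as, bs))"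
proof -
  define M where "M = max (sum_list as) (sum_list bs)"
  \<comment> \<open>\<open>B0\<close> is the base in \<open>density_bound\<close>. The program uses
    its square because \<open>p\<close> enters the sample count squared; the further factor in
    \<open>D\<close> covers the time per sample.\<close>
  define B0 where "B0 = 8 * M\<^sup>2 + 8"
  define cs where "cs = signed_coeffs as bs"
  define D where "D = B0\<^sup>2 * 8 ^ (length cs + 2)"
  have "\<exists>t. real t \<le> real (D ^ (snd I + 1)\<^sup>2) *
        time_poly (real (word_size w)) (1 / real_of_rat \<epsilon>) (log 2 (1 / real_of_rat \<delta>)) \<and>
      halts_within t (main_code cs (B0\<^sup>2), input_mem \<epsilon> \<delta> w) \<and>
      1 - real_of_rat \<delta> \<le> measure_pmf.prob (run t (main_code cs (B0\<^sup>2), input_mem \<epsilon> \<delta> w))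
        {(c, s). good_output \<epsilon> (num_eq_free_subsets (as, bs) I) s}"
    if enc: "encodes_subset_instance I w" and \<epsilon>: "0 < \<epsilon>" and \<delta>: "0 < \<delta>" "\<delta> < 1" for I w \<epsilon> \<delta>
  proof -
    obtain A k where I: "I = (A, k)" by force
    then obtain xs where xs: "distinct xs" "set xs = A" "w = int k # xs" using enc by auto
    define n where "n = length xs"
    define s where "s = input_mem \<epsilon> \<delta> w"
    define N where "N = num_eq_free_subsets (as, bs) (A, k)"
    obtain en ed where qe: "quotient_of \<epsilon> = (en, ed)" by force
    obtain dn dd where qd: "quotient_of \<delta> = (dn, dd)" by force
    have s: "s 0 = en" "s 1 = ed" "s 2 = dn" "s 3 = dd" "s 4 = int n + 1" "s 5 = int k"
      by (simp_all add: s_def input_mem_def load_def qe qd xs n_def)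
    have entry: "s (6 + int j) = xs ! j" if "j < n" for j
    proof -
      have "nat (6 + int j) = 6 + j" by simp
      then show ?thesis using that by (simp add: s_def input_mem_def load_def xs n_def)
    qed
    have "card A = n" "finite A" using xs distinct_card[of xs] by (auto simp: n_def)
    obtain b where b: "\<And>j. j < b \<Longrightarrow> 2 ^ j < int n + 1" "int n + 1 \<le> 2 ^ b" "2 ^ b \<le> 2 * (n + 1)" "b \<le> n + 1"
      using ex_doubling_count[of n] by blast
    obtain E where E: "\<And>i. i < E \<Longrightarrow> int i * s 0 < s 1" "s 1 \<le> int E * s 0" "1 \<le> E"
      "1 \<le> real E * real_of_rat \<epsilon>" "real E \<le> 1 / real_of_rat \<epsilon> + 1"
      using ex_multiple_count[OF \<epsilon> qe] unfolding s by blast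
    obtain m where m: "\<And>i. i < m \<Longrightarrow> 2 ^ i * s 2 < s 3" "s 3 \<le> 2 ^ m * s 2"
      "1 \<le> 2 ^ m * real_of_rat \<delta>" "real m \<le> log 2 (1 / real_of_rat \<delta>) + 1"
      using ex_halving_count[OF \<delta> qd] unfolding s by blast
    define T where "T = E\<^sup>2 * (m + 1) * (B0\<^sup>2) ^ (k + 1)\<^sup>2"
    define p where "p = measure_pmf.prob (draws b k) {ys. increasing_below n ys \<and>
      \<not> zero_sum ((\<lambda>j. s (6 + int j)) ` set ys) cs 0}"
    define t where "t = 7 * E + 5 * m + 21 * (k + 1)\<^sup>2 + T * (sample_time b k cs + 4) + 24"
    have main: "refines (main_code cs (B0\<^sup>2)) s t
        (\<lambda>s' h. s' 0 = int h * 2 ^ (b * k) \<and> s' 1 = int T) (binomial_pmf T p)"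
      unfolding t_def by (rule refines_main_code[OF s(5,6) b(1,2) E(1,2) m(1,2) T_def p_def])
    have "0 < B0" by (simp add: B0_def)
    then have "0 < T" using E(3) by (simp add: T_def)
    have N: "real N = p * 2 ^ (b * k)"
    proof -
      have inj: "inj_on (\<lambda>j. s (6 + int j)) {..<n}"
        using xs(1) by (auto simp: inj_on_def entry n_def nth_eq_iff_index_eq)
      have img: "(\<lambda>j. s (6 + int j)) ` {..<n} = A"
        using xs(2) by (auto simp: entry n_def set_conv_nth image_iff)
      have "int (n + 1) \<le> int (2 ^ b)" using b(2) by simp
      then have "n + 1 \<le> 2 ^ b" by (simp only: of_nat_le_iff)
      then have "n \<le> 2 ^ b" by linarith
      then have "p = real N / 2 ^ (b * k)"
        unfolding p_def N_def using prob_draws[OF inj, of b k "\<lambda>S. \<not> zero_sum S cs 0"] img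
        by (simp add: cs_def eq_free_iff[OF assms(3)])
      then show ?thesis by simp
    qed
    have p: "0 \<le> p" "p \<le> 1" by (simp_all add: p_def)
    \<comment> \<open>Both \<open>E\<close> times \<epsilon> and
      \<open>B0 ^ (k + 1)\<^sup>2 * p\<close> are at least 1, the latter by
      \<open>density_bound\<close>. The square of their product, times \<open>m + 1\<close>, is the
      right-hand side.\<close>
    have rounds: "real m + 1 \<le> real T * (real_of_rat \<epsilon> * p)\<^sup>2" if "0 < p"
    proof -
      have "0 < real N" using N that by simp
      then have "(2 ^ b) ^ k \<le> B0 ^ (k + 1)\<^sup>2 * N"
        using density_bound[OF \<open>finite A\<close> assms(3) M_def, of "2 ^ b" k] b(3) \<open>card A = n\<close>
        unfolding N_def B0_def by simp
      then have "real ((2 ^ b) ^ k) \<le> real (B0 ^ (k + 1)\<^sup>2 * N)" by (simp only: of_nat_le_iff)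
      then have "2 ^ (b * k) \<le> (real B0 ^ (k + 1)\<^sup>2 * p) * 2 ^ (b * k)" by (simp add: N power_mult)
      then have "1 \<le> real B0 ^ (k + 1)\<^sup>2 * p" by simp
      then have "1 * 1 \<le> (real E * real_of_rat \<epsilon>) * (real B0 ^ (k + 1)\<^sup>2 * p)"
        using E(4) by (intro mult_mono) auto
      then have "1 \<le> ((real E * real_of_rat \<epsilon>) * (real B0 ^ (k + 1)\<^sup>2 * p))\<^sup>2"
        using one_le_power[of _ 2] by simp
      then have "(real m + 1) * 1 \<le> (real m + 1) * ((real E * real_of_rat \<epsilon>) * (real B0 ^ (k + 1)\<^sup>2 * p))\<^sup>2"
        by (intro mult_left_mono) auto
      also have "\<dots> = real T * (real_of_rat \<epsilon> * p)\<^sup>2"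
        unfolding T_def
        by (simp only: of_nat_mult of_nat_power of_nat_add of_nat_1 power_mult_distrib power_mult[symmetric] mult_ac)
      finally show ?thesis by simp
    qed
    have "1 - real_of_rat \<delta> \<le> measure_pmf.prob (binomial_pmf T p)
        {h. \<bar>real h / real T - p\<bar> \<le> real_of_rat \<epsilon> * p}"
      by (rule binomial_relative_error[OF p _ \<open>0 < T\<close> rounds m(3)]) (use \<epsilon> in simp_all)
    also have "\<dots> \<le> measure_pmf.prob (run t (main_code cs (B0\<^sup>2), s)) {(c, s). good_output \<epsilon> N s}"
      by (rule refines_prob[OF main]) (use good_outputI[OF _ _ \<open>0 < T\<close> N] in auto)
    finally have prob: "1 - real_of_rat \<delta> \<le>
        measure_pmf.prob (run t (main_code cs (B0\<^sup>2), s)) {(c, s). good_output \<epsilon> N s}" .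
    have "length w \<le> word_size w"
      unfolding word_size_def using sum_list_mono[of w "\<lambda>_. 1" "\<lambda>x. nat (bitlen \<bar>x\<bar>) + 1"]
      by (simp add: sum_list_triv)
    then have size: "real (n + 2) \<le> real (word_size w) + 1" by (simp add: xs n_def)
    have "t \<le> D ^ (k + 1)\<^sup>2 * (200 * ((n + 2) * E\<^sup>2 * (m + 1)))"
      unfolding t_def T_def D_def using \<open>0 < B0\<close> E(3) b(4) by (intro total_time_le) auto
    then have "real t \<le> real (D ^ (k + 1)\<^sup>2 * (200 * ((n + 2) * E\<^sup>2 * (m + 1))))"
      by (simp only: of_nat_le_iff)
    also have "\<dots> = real (D ^ (k + 1)\<^sup>2) * (200 * (real (n + 2) * (real E)\<^sup>2 * (real m + 1)))"
      by (simp only: of_nat_mult of_nat_power of_nat_add of_nat_1 of_nat_numeral)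
    \<comment> \<open>\<open>n + 2\<close>, \<open>E\<^sup>2\<close> and \<open>m + 1\<close> are
      bounded by the factors x + 1, (y + 1)^2 and z + 2 of \<open>time_poly\<close>.\<close>
    also have "\<dots> \<le> real (D ^ (k + 1)\<^sup>2) *
        time_poly (real (word_size w)) (1 / real_of_rat \<epsilon>) (log 2 (1 / real_of_rat \<delta>))"
      unfolding time_poly_def using size E(5) m(4) \<epsilon>
      by (intro mult_left_mono mult_mono power_mono) auto
    finally show ?thesis
      using prob refines_halts[OF main] I unfolding s_def N_def by auto
  qed
  note bounds = this
  show ?thesis
    unfolding admits_FPTRAS_def
  proof (intro exI[of _ "main_code cs (B0\<^sup>2)"] exI[of _ "\<lambda>k. D ^ (k + 1)\<^sup>2"] exI[of _ time_poly] conjI allI impI)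
    show "computable (\<lambda>k. D ^ (k + 1)\<^sup>2)" by (rule computable_power_square)
    show "polynomial3 time_poly" by (rule polynomial3_time_poly)
  qed (elim conjE, rule bounds)
qed

end
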